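(* Let $k$ be a field and let $G$ be an arbitrary chordal graph on the vertex set $[n]=\{1,\ldots,n\}$. Let $\Delta:=\Delta(G)$ be the clique complex of $G$ and $d:=\dim(\Delta)+1$. Let $h(\Delta)=(h_0(\Delta),\ldots,h_d(\Delta))$ denote the $h$-vector of $\Delta$ (with $h_i:=h_i(\Delta)$ for $0\le i\le d$ and $h_i:=0$ for $i>d$). Let $p$ be the projective dimension of the Stanley--Reisner ring $k[\Delta]$ as a module over $R=k[x_1,\ldots,x_n]$. Then $$\sum_{\ell=0}^{j}(-1)^{\ell}h_{j-\ell}\binom{n-d}{\ell}=0$$ for each integer $j>p+2$.
   Context: Let $k$ be an arbitrary field and $R=k[x_1,\ldots,x_n]$ with the standard grading. Graphs are finite and simple. The clique complex $\Delta(G)$ of a graph $G$ on $[n]$ is the simplicial complex on $[n]$ whose faces are the subsets of $[n]$ that are cliques of $G$ (i.e. whose elements are pairwise adjacent), including the empty set and the singletons. A simplicial complex on $[n]$ is a set $\Delta$ of subsets of $[n]$, closed under taking subsets, with $\{i\}\in\Delta$ for all $i\in[n]$. Its elements are called faces; the dimension of a face is its cardinality minus one, and $\dim(\Delta)$ is the maximal dimension of a face. If $\dim(\Delta)=d-1$, then $f_i=f_i(\Delta)$ denotes the number of $i$-dimensional faces for $-1\le i\le d-1$ (so $f_{-1}=1$), and the $h$-vector $(h_0(\Delta),\ldots,h_d(\Delta))$ is defined by $H_{k[\Delta]}(z)=\frac{\sum_{i=0}^d h_i(\Delta)z^i}{(1-z)^d}$, where $H_{k[\Delta]}(z)=\sum_{s\ge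 0}\dim_k(k[\Delta]_s)z^s$ is the Hilbert series; equivalently $h_j(\Delta)=\sum_{i=0}^j(-1)^{j-i}\binom{d-i}{j-i}f_{i-1}$ for $0\le j\le d$. The Stanley--Reisner ring is $k[\Delta]=R/I(\Delta)$, where $I(\Delta)=\langle x^F: F\subseteq[n],\ F\notin\Delta\rangle$ and $x^F=\prod_{i\in F}x_i$. Convention: $\binom{m}{\ell}=0$ for $\ell>m\geq 0$. *)

theory Defs
  imports
    "HOL-Algebra.QuotRing"
    "HOL-Algebra.Module"
    "HOL-Algebra.Embedded_Algebras"
    "HOL-Computational_Algebra.Formal_Power_Series"
    "HOL-Library.Extended_Nat"
    "HOL-Library.Poly_Mapping"
    "HOL-Library.Ramsey"
begin

section \<open>Chordal graphs and simplicial complexes\<close>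

definition simple_graph :: "'v set \<Rightarrow> 'v set set \<Rightarrow> bool" where
  "simple_graph V E \<longleftrightarrow> finite V \<and> (\<forall>e\<in>E. e \<subseteq> V \<and> card e = 2)"

definition cycle_edges :: "'v list \<Rightarrow> 'v set set" where
  "cycle_edges vs = {{vs ! i, vs ! (Suc i mod length vs)} | i. i < length vs}"

definition graph_cycle :: "'v set set \<Rightarrow> 'v list \<Rightarrow> bool" where
  "graph_cycle E vs \<longleftrightarrow> 3 \<le> length vs \<and> distinct vs \<and> cycle_edges vs \<subseteq> E"

definition chordal :: "'v set set \<Rightarrow> bool" where
  "chordal E \<longleftrightarrow>
     (\<forall>vs. graph_cycle E vs \<and> 4 \<le> length vs \<longrightarrow>
        (\<exists>e\<in>E. e \<subseteq> set vs \<and> e \<notin> cycle_edges vs))"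

definition clique_complex :: "'v set \<Rightarrow> 'v set set \<Rightarrow> 'v set set" where
  "clique_complex V E = {F. F \<subseteq> V \<and> clique F E}"

text \<open>For a finite complex on a finite vertex set; the complex whose only face is the
  empty set has dimension \<open>-1\<close>.\<close>

definition complex_dim :: "'v set set \<Rightarrow> int" where
  "complex_dim \<Delta> = Max ((\<lambda>F. int (card F) - 1) ` \<Delta>)"


section \<open>Projective dimension\<close>

definition module_hom ::
    "'a ring \<Rightarrow> ('a, 'm) module \<Rightarrow> ('a, 'n) module \<Rightarrow> ('m \<Rightarrow> 'n) set" where
  "module_hom R M N = {f \<in> carrier M \<rightarrow> carrier N.
     (\<forall>x\<in>carrier M. \<forall>y\<in>carrier M. f (x \<oplus>\<^bsub>M\<^esub> y) = f x \<oplus>\<^bsub>N\<^esub> f y) \<and>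
     (\<forall>a\<in>carrier R. \<forall>x\<in>carrier M. f (a \<odot>\<^bsub>M\<^esub> x) = a \<odot>\<^bsub>N\<^esub> f x)}"

definition module_kernel ::
    "('a, 'm) module \<Rightarrow> ('a, 'n) module \<Rightarrow> ('m \<Rightarrow> 'n) \<Rightarrow> 'm set" where
  "module_kernel M N f = {x \<in> carrier M. f x = \<zero>\<^bsub>N\<^esub>}"

text \<open>The free module on a set \<open>B\<close>: finitely supported functions \<open>B \<rightarrow> R\<close>, extended by zero.
  The locale \<^locale>\<open>module\<close> does not constrain the multiplication and unit of the record, so
  these two fields are left undefined.\<close>

definition free_module :: "'a ring \<Rightarrow> 'b set \<Rightarrow> ('a, 'b \<Rightarrow> 'a) module" where
  "free_module R B =
     \<lparr>carrier = {f. (\<forall>b. f b \<in> carrier R) \<and> {b. f b \<noteq> \<zero>\<^bsub>R\<^esub>} \<subseteq> B \<and> finite {b. f b \<noteq> \<zero>\<^bsub>R\<^esub>}},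
      monoid.mult = undefined, one = undefined,
      zero = (\<lambda>b. \<zero>\<^bsub>R\<^esub>),
      add = (\<lambda>f g b. f b \<oplus>\<^bsub>R\<^esub> g b),
      smult = (\<lambda>a f b. a \<otimes>\<^bsub>R\<^esub> f b)\<rparr>"

text \<open>A module is projective if it is a direct summand (equivalently, a retract) of a free
  module.  Bases inside the carrier type of \<open>P\<close> suffice: \<open>P\<close> is a quotient of the free module
  on its own carrier, and if \<open>P\<close> is a summand of any free module then this quotient map
  splits.\<close>

definition projective_module :: "'a ring \<Rightarrow> ('a, 'm) module \<Rightarrow> bool" where
  "projective_module R P \<longleftrightarrow> module R P \<and>
     (\<exists>B :: 'm set. \<exists>\<iota> \<in> module_hom R P (free_module R B). \<exists>\<pi> \<in> module_hom R (free_module R B) P.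
        \<forall>x\<in>carrier P. \<pi> (\<iota> x) = x)"

text \<open>\<open>\<dots> \<rightarrow> P 2 \<rightarrow> P 1 \<rightarrow> P 0 \<rightarrow> M \<rightarrow> 0\<close> with maps \<open>\<delta> i : P (i + 1) \<rightarrow> P i\<close> and augmentation
  \<open>\<epsilon> : P 0 \<rightarrow> M\<close>.\<close>

definition projective_resolution ::
    "'a ring \<Rightarrow> ('a, 'm) module \<Rightarrow> (nat \<Rightarrow> ('a, 'q) module) \<Rightarrow> (nat \<Rightarrow> 'q \<Rightarrow> 'q) \<Rightarrow> ('q \<Rightarrow> 'm)
      \<Rightarrow> bool" where
  "projective_resolution R M P \<delta> \<epsilon> \<longleftrightarrow>
     (\<forall>i. projective_module R (P i)) \<and>
     \<epsilon> \<in> module_hom R (P 0) M \<and> (\<forall>i. \<delta> i \<in> module_hom R (P (Suc i)) (P i)) \<and>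
     \<epsilon> ` carrier (P 0) = carrier M \<and>
     \<delta> 0 ` carrier (P 1) = module_kernel (P 0) M \<epsilon> \<and>
     (\<forall>i. \<delta> (Suc i) ` carrier (P (Suc (Suc i))) = module_kernel (P (Suc i)) (P i) (\<delta> i))"

text \<open>The least length of a projective resolution, \<open>\<infinity>\<close> if there is no finite one (and \<open>0\<close> for the
  zero module).  HOL needs one carrier type for the modules in the resolutions.  The chosen one is
  the type of functions into \<open>R\<close> from a set of cardinality
  \<open>max (\<aleph>\<^sub>0, |'a|, |'m|)\<close>; all syzygies of \<open>M\<close> in free modules on bases of at most that
  cardinality again have at most that cardinality, so by Schanuel's lemma the
  restriction does not change the infimum, for any ring and any module.\<close>

definition projective_dimension :: "'a ring \<Rightarrow> ('a, 'm) module \<Rightarrow> enat" where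
  "projective_dimension R M = Inf {enat l | l.
     \<exists>(P :: nat \<Rightarrow> ('a, nat \<times> 'a \<times> 'm \<Rightarrow> 'a) module) \<delta> \<epsilon>.
        projective_resolution R M P \<delta> \<epsilon> \<and> (\<forall>i>l. carrier (P i) = {\<zero>\<^bsub>P i\<^esub>})}"


section \<open>Stanley--Reisner rings\<close>

text \<open>Exponent vectors are elements of \<^typ>\<open>nat \<Rightarrow>\<^sub>0 nat\<close>; the polynomial ring
  \<open>k[x\<^sub>1,\<dots>,x\<^sub>n]\<close> consists of the polynomials involving only variables with index in
  \<open>{1..n}\<close>.\<close>

type_synonym 'k mpoly = "(nat \<Rightarrow>\<^sub>0 nat) \<Rightarrow>\<^sub>0 'k"

definition poly_ring :: "nat \<Rightarrow> ('k::field) mpoly ring" where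
  "poly_ring n =
     \<lparr>carrier = {f. \<forall>m\<in>Poly_Mapping.keys f. Poly_Mapping.keys m \<subseteq> {1..n}},
      monoid.mult = (*), one = 1, zero = 0, add = (+)\<rparr>"

definition poly_var :: "nat \<Rightarrow> ('k::field) mpoly" where
  "poly_var i = Poly_Mapping.single (Poly_Mapping.single i 1) 1"

definition poly_const :: "'k \<Rightarrow> ('k::field) mpoly" where
  "poly_const c = Poly_Mapping.single 0 c"

definition monomial_degree :: "(nat \<Rightarrow>\<^sub>0 nat) \<Rightarrow> nat" where
  "monomial_degree m = (\<Sum>i\<in>Poly_Mapping.keys m. Poly_Mapping.lookup m i)"

definition homogeneous_part :: "nat \<Rightarrow> nat \<Rightarrow> ('k::field) mpoly set" where
  "homogeneous_part n s =
     {f \<in> carrier (poly_ring n). \<forall>m\<in>Poly_Mapping.keys f. monomial_degree m = s}"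

definition SR_ideal :: "nat \<Rightarrow> nat set set \<Rightarrow> ('k::field) mpoly set" where
  "SR_ideal n \<Delta> = Idl\<^bsub>poly_ring n\<^esub> {(\<Prod>i\<in>F. poly_var i) | F. F \<subseteq> {1..n} \<and> F \<notin> \<Delta>}"

definition SR_ring :: "nat \<Rightarrow> nat set set \<Rightarrow> ('k::field) mpoly set ring" where
  "SR_ring n \<Delta> = poly_ring n Quot SR_ideal n \<Delta>"

definition quotient_module :: "'a ring \<Rightarrow> 'a set \<Rightarrow> ('a, 'a set) module" where
  "quotient_module R I =
     \<lparr>carrier = carrier (R Quot I), monoid.mult = monoid.mult (R Quot I), one = \<one>\<^bsub>R Quot I\<^esub>,
      zero = \<zero>\<^bsub>R Quot I\<^esub>, add = add (R Quot I),
      smult = (\<lambda>a X. (I +>\<^bsub>R\<^esub> a) \<otimes>\<^bsub>R Quot I\<^esub> X)\<rparr>"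

definition SR_module ::
    "nat \<Rightarrow> nat set set \<Rightarrow> (('k::field) mpoly, 'k mpoly set) module" where
  "SR_module n \<Delta> = quotient_module (poly_ring n) (SR_ideal n \<Delta>)"

text \<open>The degree \<open>s\<close> part of the Stanley--Reisner ring is the image of that of the polynomial
  ring.  Its dimension is taken over the image of the coefficient field in the quotient ring.\<close>

definition SR_class :: "nat \<Rightarrow> nat set set \<Rightarrow> ('k::field) mpoly \<Rightarrow> 'k mpoly set" where
  "SR_class n \<Delta> f = SR_ideal n \<Delta> +>\<^bsub>poly_ring n\<^esub> f"

definition hilbert_series :: "'k::field itself \<Rightarrow> nat \<Rightarrow> nat set set \<Rightarrow> int fps" where
  "hilbert_series _ n \<Delta> = Abs_fps (\<lambda>s.
     int (ring.dim (SR_ring n \<Delta> :: 'k mpoly set ring)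
            (SR_class n \<Delta> ` range poly_const) (SR_class n \<Delta> ` homogeneous_part n s)))"

text \<open>The coefficients of the polynomial \<open>\<Sum>i\<le>d. h\<^sub>i z\<^sup>i = (1 - z)\<^sup>d H(z)\<close>, where \<open>H\<close> is the Hilbert
  series and \<open>d - 1\<close> the dimension of the complex, and \<open>0\<close> beyond \<open>d\<close>.\<close>

definition h_vector :: "'k::field itself \<Rightarrow> nat \<Rightarrow> nat set set \<Rightarrow> nat \<Rightarrow> int" where
  "h_vector K n \<Delta> i =
     (let d = nat (complex_dim \<Delta> + 1)
      in if i \<le> d then fps_nth (hilbert_series K n \<Delta> * (1 - fps_X) ^ d) i else 0)"

end

(* With e(W) = sum of (-1)^|F| over the cliques F inside W, the sum in question is the coefficient of
   z^j in (1 - z)^n H(z), which equals (-1)^j times the sum of e(W) over the j-sets W.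
   If G[W] is connected and nonempty, then e(W) = 0: remove a vertex v that does not disconnect G[W];
   by chordality its neighbourhood is again connected, and e(W) = e(W - v) - e(N(v)).
   If G[W] is disconnected, the first Koszul cohomology of k[Delta] with respect to the variables in W
   does not vanish.  For projective modules the Koszul cohomology vanishes below degree |W|, so dimension
   shifting along a projective resolution of length p gives |W| <= p + 1.  This replaces the linearity
   of the resolution (Froeberg) and Hochster's formula for Betti numbers. *)

theory Submission
  imports Defs
begin

text \<open>The projective dimension is defined through arbitrary projective resolutions, whose
  modules need not be graded, finitely generated or free, so no Betti numbers can be read off from
  one. The vanishing of Koszul cohomology is a usable substitute: it passes to direct summands, so
  only free modules have to be computed, and it moves along short exact sequences.

  Degree one is chosen because a disconnection of G[W] into A and B is visible there as an explicit
  cocycle, x_a on A and 0 on B. Shifting moves degree 1 for k[Delta] to degree p + 1 for the last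
  module of the resolution. Cohomology vanishes there as soon as p + 1 < |W|, and this is where the
  bound p + 1 comes from.

  On the combinatorial side the recursion for e(W) is useful only if W - v and N(v) are both
  nonempty and connected, since e is 1 at the empty set. Connectedness of W - v is arranged by the
  choice of v, that of N(v) is forced by chordality.\<close>

section \<open>Euler characteristics of chordal clique complexes\<close>

text \<open>Stated by cuts instead of paths: its negation is exactly a partition of \<open>W\<close>
  into two parts without edges between them, which is what the Koszul cocycle is built from. The
  empty set counts as connected, so nonemptiness is asked for separately.\<close>

definition graph_connected :: "'v set set \<Rightarrow> 'v set \<Rightarrow> bool" where
  "graph_connected E W \<longleftrightarrow> (\<forall>A. A \<subset> W \<and> A \<noteq> {} \<longrightarrow> (\<exists>a\<in>A. \<exists>b\<in>W - A. {a, b} \<in> E))"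

text \<open>Minus the reduced Euler characteristic of the clique complex of the induced subgraph on
  \<open>W\<close>; the empty clique is counted, so the value at \<open>{}\<close> is 1.\<close>

definition clique_euler :: "'v set set \<Rightarrow> 'v set \<Rightarrow> int" where
  "clique_euler E W = (\<Sum>F | F \<subseteq> W \<and> clique F E. (-1) ^ card F)"

lemma graph_connected_insert:
  assumes U: "graph_connected E U" and a: "a \<in> U" and b: "b \<notin> U" and ab: "{a, b} \<in> E"
  shows "graph_connected E (insert b U)"
  unfolding graph_connected_def
proof (intro allI impI, elim conjE)
  fix A assume A: "A \<subset> insert b U" "A \<noteq> {}"
  show "\<exists>x\<in>A. \<exists>y\<in>insert b U - A. {x, y} \<in> E"
  proof (cases "A \<inter> U = {} \<or> U \<subseteq> A")
    case True
    then have "A = {b} \<or> A = U" using A by auto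
    then show ?thesis using a b ab by (auto simp: insert_commute)
  next
    case False
    then have "A \<inter> U \<subset> U" "A \<inter> U \<noteq> {}" by auto
    then obtain x y where "x \<in> A \<inter> U" "y \<in> U - A \<inter> U" "{x, y} \<in> E"
      using U unfolding graph_connected_def by blast
    then show ?thesis by blast
  qed
qed

text \<open>A largest nonempty connected proper subset \<open>U\<close> misses just one vertex:
  adding the outer endpoint \<open>b\<close> of an edge leaving \<open>U\<close> keeps it connected,
  so by maximality it fills \<open>W\<close>.\<close>

lemma graph_connected_non_cut_vertex:
  assumes W: "finite W" "card W \<ge> 2" "graph_connected E W"
  obtains v where "v \<in> W" "graph_connected E (W - {v})"
proof -
  let ?P = "\<lambda>U. U \<subset> W \<and> U \<noteq> {} \<and> graph_connected E U"
  obtain w where w: "w \<in> W" using W by fastforce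
  have "?P {w}" using W w by (auto simp: graph_connected_def)
  moreover have "\<forall>U. ?P U \<longrightarrow> card U < card W" using W by (simp add: psubset_card_mono)
  ultimately obtain U where U: "?P U" and max: "\<And>U'. ?P U' \<Longrightarrow> card U' \<le> card U"
    using ex_has_greatest_nat[of ?P "{w}" card "card W"] by (meson less_imp_le)
  then obtain a b where ab: "a \<in> U" "b \<in> W - U" "{a, b} \<in> E"
    using W(3)[unfolded graph_connected_def, rule_format, of U] by blast
  have conn: "graph_connected E (insert b U)"
    using graph_connected_insert[of E U a b] U ab by auto
  have "card (insert b U) = Suc (card U)"
    using U W ab by (metis DiffD2 card_insert_disjoint finite_subset psubset_imp_subset)
  then have "\<not> insert b U \<subset> W" using max[of "insert b U"] conn by auto
  then have "insert b U = W" using U ab by auto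
  then have "W - {b} = U" using ab by auto
  then show thesis using that[of b] ab U by auto
qed

text \<open>The link of a vertex in a clique complex is again a clique complex: cliques through
  \<open>v\<close> are \<open>insert v F\<close> for cliques \<open>F\<close> among its neighbours.
  The additional element flips the sign.\<close>

lemma clique_euler_vertex:
  assumes "finite W" "v \<in> W"
  shows "clique_euler E W = clique_euler E (W - {v}) - clique_euler E {w \<in> W - {v}. {v, w} \<in> E}"
proof -
  let ?S = "\<lambda>W. {F. F \<subseteq> W \<and> clique F E}"
  let ?N = "{w \<in> W - {v}. {v, w} \<in> E}"
  have fin: "finite (?S U)" if "finite U" for U using that by simp
  have split: "?S W = ?S (W - {v}) \<union> insert v ` ?S ?N" (is "?L = ?R")
  proof
    show "?R \<subseteq> ?L" using assms(2) by (auto simp: clique_def insert_commute)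
    show "?L \<subseteq> ?R"
    proof
      fix F assume F: "F \<in> ?L"
      show "F \<in> ?R"
      proof (cases "v \<in> F")
        case True
        then have "F - {v} \<in> ?S ?N" using F by (auto simp: clique_def)
        moreover have "F = insert v (F - {v})" using True by auto
        ultimately show ?thesis by blast
      qed (use F in auto)
    qed
  qed
  have inj: "inj_on (insert v) (?S ?N)" by (auto intro!: inj_onI)
  have "(\<Sum>F\<in>insert v ` ?S ?N. (-1) ^ card F) = (\<Sum>F\<in>?S ?N. (-1 :: int) ^ card (insert v F))"
    using inj by (simp add: sum.reindex)
  also have "\<dots> = (\<Sum>F\<in>?S ?N. - ((-1) ^ card F))"
  proof (rule sum.cong[OF refl])
    fix F assume "F \<in> ?S ?N"
    then have "finite F" "v \<notin> F" using assms(1) finite_subset[of F W] by auto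
    then show "(-1 :: int) ^ card (insert v F) = - ((-1) ^ card F)" by simp
  qed
  finally have ins: "(\<Sum>F\<in>insert v ` ?S ?N. (-1) ^ card F) = - clique_euler E ?N"
    by (simp add: clique_euler_def sum_negf)
  have "clique_euler E W
      = (\<Sum>F\<in>?S (W - {v}). (-1) ^ card F) + (\<Sum>F\<in>insert v ` ?S ?N. (-1) ^ card F)"
    unfolding clique_euler_def split
    by (rule sum.union_disjoint) (use assms(1) fin in auto)
  then show ?thesis using ins by (simp add: clique_euler_def)
qed

text \<open>Vertices may repeat. Prefixes, suffixes and splices of walks are therefore walks again
  as soon as the joints are edges, and distinctness is obtained later from minimal length.\<close>

definition graph_path :: "'v set set \<Rightarrow> 'v set \<Rightarrow> 'v list \<Rightarrow> bool" where
  "graph_path E U p \<longleftrightarrow> p \<noteq> [] \<and> set p \<subseteq> U \<and> successively (\<lambda>x y. {x, y} \<in> E) p"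

text \<open>If \<open>u\<close> were not reached, the set \<open>R\<close> of vertices reached from
  \<open>A\<close> would be a nonempty proper subset, and an edge leaving \<open>R\<close> would
  prolong a walk to a vertex outside it.\<close>

lemma graph_connected_path:
  assumes "graph_connected E U" "A \<subseteq> U" "A \<noteq> {}" "u \<in> U"
  shows "\<exists>p. graph_path E U p \<and> hd p \<in> A \<and> last p = u"
proof (rule ccontr)
  assume neg: "\<not> ?thesis"
  define R where "R = {u. \<exists>p. graph_path E U p \<and> hd p \<in> A \<and> last p = u}"
  have "A \<subseteq> R"
  proof
    fix a assume "a \<in> A"
    then have "graph_path E U [a] \<and> hd [a] \<in> A \<and> last [a] = a"
      using assms(2) by (auto simp: graph_path_def)
    then show "a \<in> R" unfolding R_def by blast
  qed
  moreover have "R \<subseteq> U" unfolding R_def graph_path_def by auto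
  ultimately have "R \<subset> U" "R \<noteq> {}" using neg assms(3,4) unfolding R_def by auto
  then obtain r b where rb: "r \<in> R" "b \<in> U - R" "{r, b} \<in> E"
    using assms(1) unfolding graph_connected_def by blast
  then obtain p where "graph_path E U p" "hd p \<in> A" "last p = r" unfolding R_def by blast
  then have "graph_path E U (p @ [b]) \<and> hd (p @ [b]) \<in> A \<and> last (p @ [b]) = b"
    using rb by (auto simp: graph_path_def successively_append_iff)
  then show False using rb unfolding R_def by blast
qed

text \<open>A shortest path in \<open>W - {v}\<close> between two components of the neighbourhood of \<open>v\<close> closes up
  through \<open>v\<close> to an induced cycle of length at least 4.\<close>

lemma chordal_neighbourhood_connected:
  assumes ch: "chordal E" and E2: "\<And>e. e \<in> E \<Longrightarrow> card e = 2"
    and conn: "graph_connected E U" and v: "v \<notin> U"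
  shows "graph_connected E {w \<in> U. {v, w} \<in> E}"
proof (rule ccontr)
  let ?N = "{w \<in> U. {v, w} \<in> E}"
  assume "\<not> ?thesis"
  then obtain A where A: "A \<subset> ?N" "A \<noteq> {}" and sep: "\<And>a b. a \<in> A \<Longrightarrow> b \<in> ?N - A \<Longrightarrow> {a, b} \<notin> E"
    unfolding graph_connected_def by blast
  let ?P = "\<lambda>p. graph_path E U p \<and> hd p \<in> A \<and> last p \<in> ?N - A"
  obtain u where "u \<in> ?N - A" using A by auto
  then obtain p0 where "?P p0" using graph_connected_path[OF conn, of A u] A by fastforce
  \<comment> \<open>Minimal among all walks between the two parts, whatever their endpoints, so that
    shortening at either end is a contradiction too.\<close>
  then obtain p where p: "?P p" and min: "\<And>q. ?P q \<Longrightarrow> length p \<le> length q"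
    using ex_has_least_nat[of ?P p0 length] by blast
  define l where "l = length p"
  have p0: "p \<noteq> []" "set p \<subseteq> U" using p by (auto simp: graph_path_def)
  have adj: "{p ! i, p ! Suc i} \<in> E" if "Suc i < l" for i
    using p that by (auto simp: graph_path_def l_def successively_conv_nth)
  have hd: "p ! 0 \<in> A" and last: "p ! (l - 1) \<in> ?N - A"
    using p p0 by (auto simp: hd_conv_nth last_conv_nth l_def)
  \<comment> \<open>A single vertex cannot lie in both \<open>A\<close> and \<open>?N - A\<close>,
    and two vertices would form an edge across the cut. With \<open>v\<close> the cycle thus has
    length at least four.\<close>
  have "l \<noteq> 0" "l \<noteq> 1" "l \<noteq> 2"
    using p0 hd last adj[of 0] sep by (auto simp: l_def numeral_2_eq_2)
  then have l3: "l \<ge> 3" by linarith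
  have take: "successively (\<lambda>x y. {x, y} \<in> E) (take i p)"
    and drop: "successively (\<lambda>x y. {x, y} \<in> E) (drop i p)" for i
    using p successively_append_iff[of "\<lambda>x y. {x, y} \<in> E" "take i p" "drop i p"]
    by (simp_all add: graph_path_def)
  \<comment> \<open>The positions from \<open>i\<close> to \<open>j - 1\<close> are cut out; the
    given edge is the joint.\<close>
  have sub: "graph_path E U (take i p @ drop j p)"
    if "0 < i" "i \<le> j" "j < l" "{p ! (i - 1), p ! j} \<in> E" for i j
    using that p0 set_take_subset[of i p] set_drop_subset[of j p] take drop
    by (auto simp: graph_path_def l_def successively_append_iff last_conv_nth hd_drop_conv_nth
        min_def)
  \<comment> \<open>An inner neighbour of \<open>v\<close> would start a shorter walk if it lies in
    \<open>A\<close>, and end one otherwise.\<close>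
  have int: "p ! i \<notin> ?N" if "0 < i" "i < l - 1" for i
  proof
    assume N: "p ! i \<in> ?N"
    show False
    proof (cases "p ! i \<in> A")
      case True
      then have "?P (drop i p)"
        using p that set_drop_subset[of i p] drop
        by (auto simp: graph_path_def l_def hd_drop_conv_nth)
      then show False using min[of "drop i p"] that by (simp add: l_def)
    next
      case False
      then have "?P (take (Suc i) p)"
        using p N that set_take_subset[of "Suc i" p] take
        by (auto simp: graph_path_def l_def last_conv_nth min_def)
      then show False using min[of "take (Suc i) p"] that by (simp add: l_def)
    qed
  qed
  have short: False if "0 < i" "i < j" "j < l" "{p ! (i - 1), p ! j} \<in> E" for i j
  proof -
    have "?P (take i p @ drop j p)" using sub[of i j] that p p0 by (simp add: l_def)
    then show False using min[of "take i p @ drop j p"] that by (simp add: l_def)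
  qed
  have nochord: False if "Suc i < j" "j < l" "{p ! i, p ! j} \<in> E" for i j
    using short[of "Suc i" j] that by simp
  \<comment> \<open>A repetition lets the loop between the two positions be cut out. At
    \<open>i = 0\<close> no vertex precedes the loop, but then the suffix from \<open>j\<close>
    itself starts in \<open>A\<close>.\<close>
  have inj: False if "i < j" "j < l" "p ! i = p ! j" for i j
  proof (cases i)
    case 0
    then have "?P (drop j p)"
      using p that set_drop_subset[of j p] hd drop
      by (auto simp: graph_path_def l_def hd_drop_conv_nth)
    then show False using min[of "drop j p"] that by (simp add: l_def)
  next
    case (Suc i')
    then show False using short[of i j] adj[of i'] that by simp
  qed
  have dist: "distinct p" unfolding distinct_conv_nth using inj l_def by (metis linorder_neqE_nat)
  let ?vs = "v # p"
  have vN: "{v, p ! 0} \<in> E" "{v, p ! (l - 1)} \<in> E" using hd last A by auto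
  have ce: "cycle_edges ?vs = {{v, p ! 0}, {v, p ! (l - 1)}} \<union> {{p ! i, p ! Suc i} | i. Suc i < l}"
    (is "_ = ?C")
  proof -
    \<comment> \<open>Since \<open>v\<close> comes first, position \<open>i > 0\<close> of the cycle
      is position \<open>i - 1\<close> of \<open>p\<close>; the edge after the last position
      \<open>l\<close> wraps round to \<open>v\<close>.\<close>
    have nth: "{?vs ! i, ?vs ! (Suc i mod length ?vs)}
        = (if i = 0 then {v, p ! 0} else if i = l then {v, p ! (l - 1)} else {p ! (i - 1), p ! Suc (i - 1)})"
      if "i < length ?vs" for i
    proof (cases i)
      case 0
      then show ?thesis using l3 p0 by (simp add: l_def mod_Suc)
    next
      case (Suc k)
      show ?thesis
      proof (cases "i = l")
        case True
        then have k: "k = l - 1" using Suc by simp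
        have "Suc i mod length ?vs = 0" using True by (simp add: l_def)
        moreover have "?vs ! i = p ! (l - 1)" using Suc k by simp
        ultimately show ?thesis using True Suc by (simp add: insert_commute)
      next
        case False
        then show ?thesis using Suc that by (simp add: l_def)
      qed
    qed
    have "cycle_edges ?vs \<subseteq> ?C"
    proof
      fix e assume "e \<in> cycle_edges ?vs"
      then obtain i where i: "i < length ?vs" "e = {?vs ! i, ?vs ! (Suc i mod length ?vs)}"
        unfolding cycle_edges_def by blast
      then have "i = 0 \<or> i = l \<or> Suc (i - 1) < l" by (auto simp: l_def)
      then show "e \<in> ?C" using nth[OF i(1)] i(2) by auto
    qed
    moreover have "?C \<subseteq> cycle_edges ?vs"
    proof
      fix e assume "e \<in> ?C"
      then consider "e = {v, p ! 0}" | "e = {v, p ! (l - 1)}" | i where "Suc i < l" "e = {p ! i, p ! Suc i}"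
        by blast
      then have "\<exists>i<length ?vs. e = {?vs ! i, ?vs ! (Suc i mod length ?vs)}"
      proof cases
        case 1
        then show ?thesis using nth[of 0] by (intro exI[of _ 0]) simp
      next
        case 2
        then show ?thesis using nth[of l] l3 by (intro exI[of _ l]) (simp add: l_def)
      next
        case 3
        then show ?thesis using nth[of "Suc i"] by (intro exI[of _ "Suc i"]) (simp add: l_def)
      qed
      then show "e \<in> cycle_edges ?vs" unfolding cycle_edges_def by blast
    qed
    ultimately show ?thesis by blast
  qed
  have "graph_cycle E ?vs"
    unfolding graph_cycle_def ce using l3 dist p0 v vN adj by (auto simp: l_def)
  then obtain e where e: "e \<in> E" "e \<subseteq> set ?vs" "e \<notin> cycle_edges ?vs"
    using ch[unfolded chordal_def, rule_format, of ?vs] l3 by (auto simp: l_def)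
  obtain x y where xy: "e = {x, y}" "x \<noteq> y" using E2[OF e(1)] by (auto simp: card_2_iff)
  have vcase: "{v, w} \<in> cycle_edges ?vs" if w: "{v, w} \<in> E" "w \<in> set p" for w
  proof -
    obtain i where i: "i < l" "w = p ! i" using w(2) by (auto simp: in_set_conv_nth l_def)
    have "p ! i \<in> ?N" using w i p0 by auto
    then have "i = 0 \<or> i = l - 1" using int[of i] i by linarith
    then show ?thesis unfolding ce using i by auto
  qed
  \<comment> \<open>A chord at \<open>v\<close> would end at an inner vertex of \<open>p\<close>,
    against \<open>int\<close>; a chord between two vertices of \<open>p\<close> is excluded by
    \<open>nochord\<close>.\<close>
  show False
  proof (cases "v \<in> e")
    case True
    then obtain w where "e = {v, w}" "w \<noteq> v" using xy by auto
    then show False using vcase[of w] e by auto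
  next
    case False
    then have "x \<in> set p" "y \<in> set p" using e(2) xy by auto
    then obtain i j where ij: "i < l" "j < l" "x = p ! i" "y = p ! j"
      by (auto simp: in_set_conv_nth l_def)
    have *: False if "i < j" "j < l" "e = {p ! i, p ! j}" for i j
    proof (cases "j = Suc i")
      case True
      then show False using e(3) that unfolding ce by blast
    next
      case False
      then show False using nochord[of i j] that e(1) by auto
    qed
    show False using *[of i j] *[of j i] ij xy by (metis insert_commute linorder_neqE_nat)
  qed
qed

lemma chordal_connected_clique_euler:
  assumes ch: "chordal E" and E2: "\<And>e. e \<in> E \<Longrightarrow> card e = 2"
    and "finite W" "W \<noteq> {}" "graph_connected E W"
  shows "clique_euler E W = 0"
  using assms(3-5)
proof (induction "card W" arbitrary: W rule: less_induct)
  case less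
  show ?case
  proof (cases "card W \<ge> 2")
    case False
    moreover have "card W \<noteq> 0" using less.prems by simp
    ultimately have "card W = 1" by linarith
    then obtain v where "W = {v}" by (auto simp: card_1_singleton_iff)
    then have "{F. F \<subseteq> W \<and> clique F E} = {{}, {v}}" by (auto simp: clique_def)
    then show ?thesis by (simp add: clique_euler_def)
  next
    case True
    then obtain v where v: "v \<in> W" "graph_connected E (W - {v})"
      using graph_connected_non_cut_vertex less.prems by metis
    let ?N = "{w \<in> W - {v}. {v, w} \<in> E}"
    have card: "card (W - {v}) < card W" using v less.prems by (meson card_Diff1_less)
    then have "card ?N < card W"
      using less.prems by (metis (no_types, lifting) card_mono finite_Diff le_less_trans mem_Collect_eq subsetI)
    \<comment> \<open>The induction hypothesis does not cover the empty set. As \<open>W\<close> has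
      at least two vertices, connectedness gives \<open>v\<close> a neighbour, so neither
      \<open>W - {v}\<close> nor \<open>?N\<close> is empty.\<close>
    have "W \<noteq> {v}" using True by auto
    then have "{v} \<subset> W" using v by auto
    then obtain w where "w \<in> W - {v}" "{v, w} \<in> E"
      using less.prems(3) unfolding graph_connected_def by blast
    then have "?N \<noteq> {}" by blast
    have "W - {v} \<noteq> {}" using \<open>{v} \<subset> W\<close> by blast
    have "clique_euler E ?N = 0"
      using less.hyps[OF \<open>card ?N < card W\<close>] chordal_neighbourhood_connected[OF ch E2 v(2)]
        less.prems(1) \<open>?N \<noteq> {}\<close> by simp
    moreover have "clique_euler E (W - {v}) = 0"
      using less.hyps[OF card] v(2) less.prems(1) \<open>W - {v} \<noteq> {}\<close> by simp
    ultimately show ?thesis using clique_euler_vertex[OF less.prems(1) v(1), of E] by simp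
  qed
qed

section \<open>Koszul cohomology and projective resolutions\<close>

text \<open>The Koszul cochain differential: at \<open>T\<close> it sums \<open>x t\<close> times
  \<open>c (T - {t})\<close> over the \<open>t \<in> T\<close> occurring in the list, with signs
  alternating in list order. The recursion is the mapping cone of multiplication by
  \<open>x y\<close>; it keeps the signs implicit and suits induction on the list.\<close>

primrec koszul_d :: "('a, 'm, 'z) module_scheme \<Rightarrow> ('i \<Rightarrow> 'a) \<Rightarrow> 'i list \<Rightarrow> ('i set \<Rightarrow> 'm) \<Rightarrow> 'i set \<Rightarrow> 'm" where
  "koszul_d M x [] c T = \<zero>\<^bsub>M\<^esub>"
| "koszul_d M x (y # ys) c T =
     (if y \<in> T then x y \<odot>\<^bsub>M\<^esub> c (T - {y}) \<ominus>\<^bsub>M\<^esub> koszul_d M x ys (\<lambda>U. c (insert y U)) (T - {y})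
      else koszul_d M x ys c T)"

text \<open>Vanishing of cohomology in degree \<open>i\<close>. The coefficients \<open>C\<close>
  are a mere subset, so that kernels and images inside a module can be used without giving them a
  module record. Cochains are total functions, of which only the values on subsets of the right size
  matter.\<close>

definition koszul_exact ::
    "('a, 'm, 'z) module_scheme \<Rightarrow> ('i \<Rightarrow> 'a) \<Rightarrow> 'i list \<Rightarrow> 'm set \<Rightarrow> nat \<Rightarrow> bool" where
  "koszul_exact M x ys C i \<longleftrightarrow>
     (\<forall>c. range c \<subseteq> C \<and> (\<forall>T\<subseteq>set ys. card T = Suc i \<longrightarrow> koszul_d M x ys c T = \<zero>\<^bsub>M\<^esub>) \<longrightarrow>
        (\<exists>b. range b \<subseteq> C \<and> (\<forall>T\<subseteq>set ys. card T = i \<longrightarrow> c T = koszul_d M x ys b T)))"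

text \<open>\<open>koszul_d M x ys b (set ys)\<close> runs through the submodule generated by the
  multiples of the \<open>x t\<close> with \<open>t \<in> set ys\<close>. The condition says that
  \<open>x y\<close> is a nonzerodivisor modulo it, so the list, read from its end, behaves like a
  regular sequence.\<close>

primrec koszul_regular ::
    "('a, 'm, 'z) module_scheme \<Rightarrow> ('i \<Rightarrow> 'a) \<Rightarrow> 'i list \<Rightarrow> bool" where
  "koszul_regular M x [] = True"
| "koszul_regular M x (y # ys) = (koszul_regular M x ys \<and>
     (\<forall>a\<in>carrier M. \<forall>b. range b \<subseteq> carrier M \<and> x y \<odot>\<^bsub>M\<^esub> a = koszul_d M x ys b (set ys) \<longrightarrow>
        (\<exists>b'. range b' \<subseteq> carrier M \<and> a = koszul_d M x ys b' (set ys))))"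

section \<open>Algebra of the Koszul differential\<close>

lemma koszul_d_cong:
  assumes "\<And>t. t \<in> T \<Longrightarrow> c (T - {t}) = c' (T - {t})"
  shows "koszul_d M x ys c T = koszul_d M x ys c' T"
  using assms
proof (induction ys arbitrary: c c' T)
  case Nil
  show ?case by simp
next
  case (Cons y ys)
  show ?case
  proof (cases "y \<in> T")
    case True
    have "koszul_d M x ys (\<lambda>U. c (insert y U)) (T - {y})
        = koszul_d M x ys (\<lambda>U. c' (insert y U)) (T - {y})"
    proof (rule Cons.IH)
      fix t assume t: "t \<in> T - {y}"
      then have "insert y (T - {y} - {t}) = T - {t}" using True by auto
      then show "c (insert y (T - {y} - {t})) = c' (insert y (T - {y} - {t}))"
        using Cons.prems t by simp
    qed
    then show ?thesis using True Cons.prems by simp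
  next
    case False
    then show ?thesis using Cons.IH[of T c c'] Cons.prems by simp
  qed
qed

lemma (in abelian_group) a_inv_zero: "\<ominus> \<zero> = \<zero>"
  using minus_equality[of \<zero> \<zero>] by simp

lemma (in abelian_group) minus_minus_cancel:
  assumes "u \<in> carrier G" "v \<in> carrier G"
  shows "u \<ominus> (u \<ominus> v) = v"
proof -
  have "u \<ominus> (u \<ominus> v) = u \<oplus> (\<ominus> u \<oplus> v)"
    using assms by (simp add: minus_eq minus_add)
  then show ?thesis using assms by (simp add: r_neg2)
qed

lemma (in abelian_group) minus_zero_imp_eq:
  assumes "u \<ominus> v = \<zero>" "u \<in> carrier G" "v \<in> carrier G"
  shows "u = v"
  using assms minus_equality[of u "\<ominus> v"] by (simp add: minus_eq)

context module
begin

lemma koszul_d_closed: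
  assumes "x ` set ys \<subseteq> carrier R" "range c \<subseteq> carrier M"
  shows "koszul_d M x ys c T \<in> carrier M"
  using assms
proof (induction ys arbitrary: c T)
  case Nil
  show ?case by simp
next
  case (Cons y ys)
  have "range (\<lambda>U. c (insert y U)) \<subseteq> carrier M" using Cons.prems by auto
  moreover have "c (T - {y}) \<in> carrier M" using Cons.prems by auto
  ultimately show ?case using Cons.IH Cons.prems by simp
qed

text \<open>A multiple of one cochain minus another is the shape that the recursion produces at
  \<open>y\<close>; differences and negatives are special cases.\<close>

lemma koszul_d_smult_minus:
  assumes "x ` set ys \<subseteq> carrier R" "range c \<subseteq> carrier M" "range b \<subseteq> carrier M" "a \<in> carrier R"
  shows "koszul_d M x ys (\<lambda>U. a \<odot>\<^bsub>M\<^esub> c U \<ominus>\<^bsub>M\<^esub> b U) T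
       = a \<odot>\<^bsub>M\<^esub> koszul_d M x ys c T \<ominus>\<^bsub>M\<^esub> koszul_d M x ys b T"
  using assms(1-3)
proof (induction ys arbitrary: c b T)
  case Nil
  show ?case using assms(4) by (simp add: a_minus_def M.r_neg)
next
  case (Cons y ys)
  have y: "x y \<in> carrier R" and ys: "x ` set ys \<subseteq> carrier R" using Cons.prems by auto
  have r: "range (\<lambda>U. c (insert y U)) \<subseteq> carrier M" "range (\<lambda>U. b (insert y U)) \<subseteq> carrier M"
    using Cons.prems by auto
  have cb: "c U \<in> carrier M" "b U \<in> carrier M" for U using Cons.prems by auto
  define p where "p = koszul_d M x ys (\<lambda>U. c (insert y U)) (T - {y})"
  define q where "q = koszul_d M x ys (\<lambda>U. b (insert y U)) (T - {y})"
  have pq: "p \<in> carrier M" "q \<in> carrier M"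
    unfolding p_def q_def using koszul_d_closed[OF ys] r by auto
  have IH: "koszul_d M x ys (\<lambda>U. a \<odot>\<^bsub>M\<^esub> c (insert y U) \<ominus>\<^bsub>M\<^esub> b (insert y U)) (T - {y})
      = a \<odot>\<^bsub>M\<^esub> p \<ominus>\<^bsub>M\<^esub> q"
    unfolding p_def q_def by (rule Cons.IH[OF ys r])
  have comm: "x y \<odot>\<^bsub>M\<^esub> (a \<odot>\<^bsub>M\<^esub> c (T - {y})) = a \<odot>\<^bsub>M\<^esub> (x y \<odot>\<^bsub>M\<^esub> c (T - {y}))"
    using y assms(4) cb by (metis R.m_comm smult_assoc1)
  show ?case
  proof (cases "y \<in> T")
    case True
    then have "koszul_d M x (y # ys) (\<lambda>U. a \<odot>\<^bsub>M\<^esub> c U \<ominus>\<^bsub>M\<^esub> b U) T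
        = x y \<odot>\<^bsub>M\<^esub> (a \<odot>\<^bsub>M\<^esub> c (T - {y}) \<ominus>\<^bsub>M\<^esub> b (T - {y})) \<ominus>\<^bsub>M\<^esub> (a \<odot>\<^bsub>M\<^esub> p \<ominus>\<^bsub>M\<^esub> q)"
      by (simp add: IH)
    then show ?thesis
      using True y assms(4) cb pq
      by (simp add: p_def[symmetric] q_def[symmetric] a_minus_def smult_r_distr smult_r_minus
          comm M.minus_add M.a_ac)
  next
    case False
    then show ?thesis using Cons.IH[OF ys] Cons.prems by simp
  qed
qed

lemma koszul_d_minus:
  assumes "x ` set ys \<subseteq> carrier R" "range c \<subseteq> carrier M" "range b \<subseteq> carrier M"
  shows "koszul_d M x ys (\<lambda>U. c U \<ominus>\<^bsub>M\<^esub> b U) T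
       = koszul_d M x ys c T \<ominus>\<^bsub>M\<^esub> koszul_d M x ys b T"
proof -
  have "c U \<in> carrier M" for U using assms by auto
  then show ?thesis
    using koszul_d_smult_minus[OF assms, of \<one>] koszul_d_closed[OF assms(1,2)] by simp
qed

lemma koszul_d_zero:
  assumes "x ` set ys \<subseteq> carrier R"
  shows "koszul_d M x ys (\<lambda>U. \<zero>\<^bsub>M\<^esub>) T = \<zero>\<^bsub>M\<^esub>"
  using assms by (induction ys arbitrary: T) (auto simp: a_minus_def M.r_neg)

lemma koszul_d_uminus:
  assumes "x ` set ys \<subseteq> carrier R" "range c \<subseteq> carrier M"
  shows "koszul_d M x ys (\<lambda>U. \<ominus>\<^bsub>M\<^esub> c U) T = \<ominus>\<^bsub>M\<^esub> koszul_d M x ys c T"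
proof -
  have "c U \<in> carrier M" for U using assms by auto
  then show ?thesis
    using koszul_d_minus[OF assms(1) _ assms(2), of "\<lambda>U. \<zero>\<^bsub>M\<^esub>"]
      koszul_d_closed[OF assms(1,2)] by (simp add: a_minus_def koszul_d_zero assms(1))
qed

text \<open>For \<open>y \<in> T\<close> both contributions equal \<open>x y\<close> times the
  differential of \<open>c\<close> along \<open>ys\<close> at \<open>T - {y}\<close> and cancel; the
  remaining double differential along \<open>ys\<close> vanishes by induction.\<close>

lemma koszul_d_d:
  assumes "x ` set ys \<subseteq> carrier R" "range c \<subseteq> carrier M"
  shows "koszul_d M x ys (koszul_d M x ys c) T = \<zero>\<^bsub>M\<^esub>"
  using assms
proof (induction ys arbitrary: c T)
  case Nil
  show ?case by simp
next
  case (Cons y ys)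
  have y: "x y \<in> carrier R" and ys: "x ` set ys \<subseteq> carrier R" using Cons.prems by auto
  have r: "range (\<lambda>U. c (insert y U)) \<subseteq> carrier M" using Cons.prems by auto
  show ?case
  proof (cases "y \<in> T")
    case False
    have "koszul_d M x ys (koszul_d M x (y # ys) c) T = koszul_d M x ys (koszul_d M x ys c) T"
      by (rule koszul_d_cong) (use False in auto)
    then show ?thesis using False Cons.IH[OF ys Cons.prems(2)] by (simp del: koszul_d.simps(2) add: koszul_d.simps(2)[where T=T])
  next
    case True
    let ?e = "koszul_d M x ys (\<lambda>V. c (insert y V))"
    have "koszul_d M x ys (\<lambda>U. koszul_d M x (y # ys) c (insert y U)) (T - {y})
       = koszul_d M x ys (\<lambda>U. x y \<odot>\<^bsub>M\<^esub> c U \<ominus>\<^bsub>M\<^esub> ?e U) (T - {y})"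
      by (rule koszul_d_cong) (auto simp: insert_Diff_if)
    also have "\<dots> = x y \<odot>\<^bsub>M\<^esub> koszul_d M x ys c (T - {y}) \<ominus>\<^bsub>M\<^esub> koszul_d M x ys ?e (T - {y})"
      by (rule koszul_d_smult_minus[OF ys]) (use Cons.prems y koszul_d_closed[OF ys r] in auto)
    also have "\<dots> = x y \<odot>\<^bsub>M\<^esub> koszul_d M x ys c (T - {y})"
      using Cons.IH[OF ys r] koszul_d_closed[OF ys Cons.prems(2)] y by (simp add: a_minus_def)
    finally show ?thesis
      using True koszul_d_closed[OF ys Cons.prems(2)] y
      by (simp add: a_minus_def M.r_neg)
  qed
qed

text \<open>Long exact sequence for adjoining one element \<open>y\<close>: the Koszul complex of \<open>y # ys\<close> is the
  mapping cone of multiplication by \<open>x y\<close> on that of \<open>ys\<close>.\<close>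

lemma koszul_regular_exact:
  assumes "koszul_regular M x ys" "x ` set ys \<subseteq> carrier R" "distinct ys" "i < length ys"
  shows "koszul_exact M x ys (carrier M) i"
  using assms
proof (induction ys arbitrary: i)
  case Nil
  then show ?case by simp
next
  case (Cons y ys)
  have y: "x y \<in> carrier R" and ys: "x ` set ys \<subseteq> carrier R" and yn: "y \<notin> set ys" 
    and d: "distinct ys" and reg: "koszul_regular M x ys"
    using Cons.prems by auto
  show ?case unfolding koszul_exact_def
  proof (intro allI impI)
    fix c assume c: "range c \<subseteq> carrier M \<and>
      (\<forall>T\<subseteq>set (y # ys). card T = Suc i \<longrightarrow> koszul_d M x (y # ys) c T = \<zero>\<^bsub>M\<^esub>)"
    then have cr: "range c \<subseteq> carrier M" and cM: "\<And>U. c U \<in> carrier M" by auto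
    have r: "range (\<lambda>U. c (insert y U)) \<subseteq> carrier M" using cr by auto
    \<comment> \<open>The cocycle condition of the cone, split at \<open>y\<close>. On sets without
      \<open>y\<close>, \<open>c\<close> is a cocycle along \<open>ys\<close>; on sets with
      \<open>y\<close> (fact \<open>c2\<close>), \<open>x y\<close> times \<open>c\<close> is the
      coboundary of the \<open>y\<close>-part of \<open>c\<close>.\<close>
    have c1: "koszul_d M x ys c T = \<zero>\<^bsub>M\<^esub>" if "T \<subseteq> set ys" "card T = Suc i" for T
    proof -
      have "T \<subseteq> set (y # ys)" "y \<notin> T" using that yn by auto
      then show ?thesis using c[THEN conjunct2, rule_format, of T] that(2) by simp
    qed
    have c2: "x y \<odot>\<^bsub>M\<^esub> c T = koszul_d M x ys (\<lambda>U. c (insert y U)) T"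
      if T: "T \<subseteq> set ys" "card T = i" for T
    proof -
      have f: "finite T" "y \<notin> T" using T yn finite_subset by auto
      have "koszul_d M x (y # ys) c (insert y T) = \<zero>\<^bsub>M\<^esub>"
        using c[THEN conjunct2, rule_format, of "insert y T"] T f by auto
      then have "x y \<odot>\<^bsub>M\<^esub> c T \<ominus>\<^bsub>M\<^esub> koszul_d M x ys (\<lambda>U. c (insert y U)) T = \<zero>\<^bsub>M\<^esub>"
        using f by simp
      then show ?thesis using y cM koszul_d_closed[OF ys r] by (simp add: M.minus_zero_imp_eq)
    qed
    \<comment> \<open>In the top degree \<open>i = length ys\<close> the induction hypothesis gives
      nothing. The only set there is \<open>set ys\<close>; \<open>c2\<close> puts
      \<open>x y\<close> times the value of \<open>c\<close> into the image of the last
      differential, and regularity cancels \<open>x y\<close>.\<close>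
    have "\<exists>a. range a \<subseteq> carrier M \<and> (\<forall>T\<subseteq>set ys. card T = i \<longrightarrow> c T = koszul_d M x ys a T)"
    proof (cases "i < length ys")
      case True
      then show ?thesis using Cons.IH[OF reg ys d True] c1 cr unfolding koszul_exact_def by blast
    next
      case False
      then have i: "i = length ys" using Cons.prems by simp
      have reg_y: "\<forall>a\<in>carrier M. \<forall>b. range b \<subseteq> carrier M \<and>
          x y \<odot>\<^bsub>M\<^esub> a = koszul_d M x ys b (set ys) \<longrightarrow>
          (\<exists>b'. range b' \<subseteq> carrier M \<and> a = koszul_d M x ys b' (set ys))"
        using Cons.prems(1) by simp
      from i have "card (set ys) = i" using d by (simp add: distinct_card)
      then obtain a where a: "range a \<subseteq> carrier M" "c (set ys) = koszul_d M x ys a (set ys)"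
        using c2[of "set ys"] reg_y cM r by blast
      moreover have "T = set ys" if "T \<subseteq> set ys" "card T = i" for T
        using that \<open>card (set ys) = i\<close> by (metis List.finite_set card_subset_eq)
      ultimately show ?thesis by blast
    qed
    then obtain a where a: "range a \<subseteq> carrier M"
      and ca: "\<And>T. T \<subseteq> set ys \<Longrightarrow> card T = i \<Longrightarrow> c T = koszul_d M x ys a T" by blast
    have aM: "a U \<in> carrier M" for U using a by auto
    \<comment> \<open>A primitive with parts \<open>a\<close> off \<open>y\<close> and
      \<open>b\<close> on \<open>y\<close> must satisfy that \<open>x y\<close> times
      \<open>a\<close> minus the differential of \<open>b\<close> is the \<open>y\<close>-part of
      \<open>c\<close>. So \<open>e\<close> is the required differential of \<open>b\<close>, and
      \<open>c2\<close> makes it a cocycle.\<close>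
    define e where "e U = x y \<odot>\<^bsub>M\<^esub> a U \<ominus>\<^bsub>M\<^esub> c (insert y U)" for U
    have e: "range e \<subseteq> carrier M" using aM cM y unfolding e_def by auto
    have de: "koszul_d M x ys e T = \<zero>\<^bsub>M\<^esub>" if "T \<subseteq> set ys" "card T = i" for T
    proof -
      have "koszul_d M x ys e T = x y \<odot>\<^bsub>M\<^esub> c T \<ominus>\<^bsub>M\<^esub> koszul_d M x ys (\<lambda>U. c (insert y U)) T"
        unfolding e_def using koszul_d_smult_minus[OF ys a r y] ca[OF that] by simp
      then show ?thesis
        using c2[OF that] koszul_d_closed[OF ys r] by (simp add: M.minus_eq M.r_neg)
    qed
    \<comment> \<open>With \<open>Suc (card T) = i\<close> in place of \<open>card T = i - 1\<close>
      the condition is vacuous for \<open>i = 0\<close>.\<close>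
    have "\<exists>b. range b \<subseteq> carrier M \<and>
        (\<forall>T\<subseteq>set ys. Suc (card T) = i \<longrightarrow> e T = koszul_d M x ys b T)"
    proof (cases i)
      case 0
      then show ?thesis by (intro exI[of _ "\<lambda>U. \<zero>\<^bsub>M\<^esub>"]) auto
    next
      case (Suc i')
      then have "koszul_exact M x ys (carrier M) i'" using Cons.IH[OF reg ys d, of i'] Cons.prems by simp
      then show ?thesis using e de Suc unfolding koszul_exact_def by simp
    qed
    then obtain b where b: "range b \<subseteq> carrier M"
      and eb: "\<And>T. T \<subseteq> set ys \<Longrightarrow> Suc (card T) = i \<Longrightarrow> e T = koszul_d M x ys b T" by blast
    have bM: "b U \<in> carrier M" for U using b by auto
    define g where "g U = (if y \<in> U then b (U - {y}) else a U)" for U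
    have gM: "range g \<subseteq> carrier M" using aM bM unfolding g_def by auto
    have "c T = koszul_d M x (y # ys) g T" if T: "T \<subseteq> set (y # ys)" "card T = i" for T
    proof (cases "y \<in> T")
      case False
      then have T': "T \<subseteq> set ys" using T by auto
      have "koszul_d M x ys g T = koszul_d M x ys a T"
        by (rule koszul_d_cong) (use False in \<open>auto simp: g_def\<close>)
      then show ?thesis using False ca[OF T' T(2)] by simp
    next
      case True
      have T': "T - {y} \<subseteq> set ys" using T by auto
      have "finite T" using T finite_subset by blast
      then have cT': "Suc (card (T - {y})) = i" using True T(2) by (metis card_Suc_Diff1)
      have "koszul_d M x ys (\<lambda>U. g (insert y U)) (T - {y}) = koszul_d M x ys b (T - {y})"
        by (rule koszul_d_cong) (auto simp: g_def insert_Diff_if)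
      also have "\<dots> = x y \<odot>\<^bsub>M\<^esub> a (T - {y}) \<ominus>\<^bsub>M\<^esub> c T"
        using eb[OF T' cT'] True by (simp add: e_def insert_absorb)
      finally show ?thesis using True y aM cM
        by (simp add: g_def M.minus_minus_cancel)
    qed
    then show "\<exists>b. range b \<subseteq> carrier M \<and>
        (\<forall>T\<subseteq>set (y # ys). card T = i \<longrightarrow> c T = koszul_d M x (y # ys) b T)"
      using gM by blast
  qed
qed

lemma koszul_d_singleton:
  assumes "x ` set ys \<subseteq> carrier R" "range c \<subseteq> carrier M" "t \<in> set ys"
  shows "koszul_d M x ys c {t} = x t \<odot>\<^bsub>M\<^esub> c {}"
  using assms
proof (induction ys arbitrary: c)
  case (Cons y ys)
  have c: "c {} \<in> carrier M" using Cons.prems by auto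
  have "koszul_d M x ys b {} = \<zero>\<^bsub>M\<^esub>" for b ys by (induction ys) auto
  then show ?case using Cons c by (auto simp: M.minus_eq)
qed simp

text \<open>On a pair the differential is, up to a sign depending on the list order, the difference
  of the two sides of the assumed equation.\<close>

lemma koszul_d_cocycle_pairs:
  assumes "x ` set ys \<subseteq> carrier R" "range c \<subseteq> carrier M" "distinct ys"
    and "\<And>s t. s \<in> set ys \<Longrightarrow> t \<in> set ys \<Longrightarrow> s \<noteq> t \<Longrightarrow> x s \<odot>\<^bsub>M\<^esub> c {t} = x t \<odot>\<^bsub>M\<^esub> c {s}"
    and "T \<subseteq> set ys" "card T = 2"
  shows "koszul_d M x ys c T = \<zero>\<^bsub>M\<^esub>"
proof (cases "finite T")
  case True
  have *: "koszul_d M x zs b {} = \<zero>\<^bsub>M\<^esub>" for b zs by (induction zs) auto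
  show ?thesis using assms
  proof (induction ys)
    case (Cons y ys)
    have y: "x y \<in> carrier R" and ys: "x ` set ys \<subseteq> carrier R" using Cons.prems by auto
    have r: "range (\<lambda>U. c (insert y U)) \<subseteq> carrier M" and cM: "\<And>U. c U \<in> carrier M"
      using Cons.prems by auto
    show ?case
    proof (cases "y \<in> T")
      case True
      then obtain t where t: "T - {y} = {t}" "t \<in> set ys" "t \<noteq> y"
        using Cons.prems(5,6) by (auto simp: card_2_iff insert_Diff_if split: if_splits)
      have "x y \<odot>\<^bsub>M\<^esub> c {t} = x t \<odot>\<^bsub>M\<^esub> c {y}" using Cons.prems(4) t by simp
      then show ?thesis
        using True t y ys cM koszul_d_singleton[OF ys r t(2)] by (auto simp add: M.minus_eq M.r_neg)
    next
      case False
      then show ?thesis using Cons by auto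
    qed
  qed simp
qed (use assms in auto)

end

section \<open>Module homomorphisms and dimension shifting\<close>

lemma module_hom_zero:
  assumes "module R M" "module R N" "f \<in> module_hom R M N"
  shows "f \<zero>\<^bsub>M\<^esub> = \<zero>\<^bsub>N\<^esub>"
proof -
  interpret M: module R M by fact
  interpret N: module R N by fact
  have "f (\<zero>\<^bsub>R\<^esub> \<odot>\<^bsub>M\<^esub> \<zero>\<^bsub>M\<^esub>) = \<zero>\<^bsub>R\<^esub> \<odot>\<^bsub>N\<^esub> f \<zero>\<^bsub>M\<^esub>" "f \<zero>\<^bsub>M\<^esub> \<in> carrier N"
    using assms(3) M.M.zero_closed M.R.zero_closed unfolding module_hom_def by blast+
  then show ?thesis by simp
qed

lemma module_hom_minus:
  assumes "module R M" "module R N" "f \<in> module_hom R M N" "u \<in> carrier M" "v \<in> carrier M"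
  shows "f (u \<ominus>\<^bsub>M\<^esub> v) = f u \<ominus>\<^bsub>N\<^esub> f v"
proof -
  interpret M: module R M by fact
  interpret N: module R N by fact
  have f: "f u \<in> carrier N" "f v \<in> carrier N"
    using assms(3-) unfolding module_hom_def by auto
  have "u \<ominus>\<^bsub>M\<^esub> v = u \<oplus>\<^bsub>M\<^esub> (\<ominus>\<^bsub>R\<^esub> \<one>\<^bsub>R\<^esub>) \<odot>\<^bsub>M\<^esub> v"
    using assms by (simp add: M.M.minus_eq M.smult_l_minus)
  also have "f \<dots> = f u \<oplus>\<^bsub>N\<^esub> (\<ominus>\<^bsub>R\<^esub> \<one>\<^bsub>R\<^esub>) \<odot>\<^bsub>N\<^esub> f v"
    using assms(3-) unfolding module_hom_def by simp
  also have "\<dots> = f u \<ominus>\<^bsub>N\<^esub> f v"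
    using f by (simp add: N.M.minus_eq N.smult_l_minus)
  finally show ?thesis .
qed

lemma koszul_d_hom:
  assumes "module R M" "module R N" "f \<in> module_hom R M N"
    and "x ` set ys \<subseteq> carrier R" "range c \<subseteq> carrier M"
  shows "f (koszul_d M x ys c T) = koszul_d N x ys (\<lambda>U. f (c U)) T"
  using assms(4,5)
proof (induction ys arbitrary: c T)
  case Nil
  show ?case using module_hom_zero[OF assms(1-3)] by simp
next
  case (Cons y ys)
  interpret M: module R M by fact
  have y: "x y \<in> carrier R" and ys: "x ` set ys \<subseteq> carrier R" using Cons.prems by auto
  have r: "range (\<lambda>U. c (insert y U)) \<subseteq> carrier M" and cM: "\<And>U. c U \<in> carrier M"
    using Cons.prems by auto
  have "f (x y \<odot>\<^bsub>M\<^esub> c U) = x y \<odot>\<^bsub>N\<^esub> f (c U)" for U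
    using assms(3) y cM unfolding module_hom_def by simp
  then show ?case
    using Cons.IH[OF ys r] Cons.IH[OF ys Cons.prems(2)] y cM M.koszul_d_closed[OF ys r]
    by (simp add: module_hom_minus[OF assms(1-3)])
qed

text \<open>A cocycle is sent to \<open>N\<close>, bounded there, and the primitive is sent back.
  This is how projective modules inherit exactness from free ones.\<close>

lemma koszul_exact_retract:
  assumes M: "module R M" and N: "module R N"
    and f: "f \<in> module_hom R M N" and g: "g \<in> module_hom R N M"
    and gf: "\<And>u. u \<in> carrier M \<Longrightarrow> g (f u) = u"
    and x: "x ` set ys \<subseteq> carrier R"
    and N_exact: "koszul_exact N x ys (carrier N) i"
  shows "koszul_exact M x ys (carrier M) i"
  unfolding koszul_exact_def
proof (intro allI impI)
  fix c assume c: "range c \<subseteq> carrier M \<and>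
      (\<forall>T\<subseteq>set ys. card T = Suc i \<longrightarrow> koszul_d M x ys c T = \<zero>\<^bsub>M\<^esub>)"
  have fM: "f u \<in> carrier N" if "u \<in> carrier M" for u using f that unfolding module_hom_def by auto
  have gN: "g u \<in> carrier M" if "u \<in> carrier N" for u using g that unfolding module_hom_def by auto
  have "range (\<lambda>U. f (c U)) \<subseteq> carrier N" using c fM by auto
  moreover have "koszul_d N x ys (\<lambda>U. f (c U)) T = \<zero>\<^bsub>N\<^esub>" if "T \<subseteq> set ys" "card T = Suc i" for T
    using koszul_d_hom[OF M N f x, of c T] c that module_hom_zero[OF M N f] by simp
  ultimately obtain b where b: "range b \<subseteq> carrier N"
    and cb: "\<And>T. T \<subseteq> set ys \<Longrightarrow> card T = i \<Longrightarrow> f (c T) = koszul_d N x ys b T"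
    using N_exact unfolding koszul_exact_def by blast
  have "c T = koszul_d M x ys (\<lambda>U. g (b U)) T" if "T \<subseteq> set ys" "card T = i" for T
  proof -
    have "c T \<in> carrier M" using c by blast
    then show ?thesis using koszul_d_hom[OF N M g x b, of T] cb[OF that] gf[of "c T"] by simp
  qed
  moreover have "range (\<lambda>U. g (b U)) \<subseteq> carrier M" using b gN by auto
  ultimately show "\<exists>b. range b \<subseteq> carrier M \<and> (\<forall>T\<subseteq>set ys. card T = i \<longrightarrow> c T = koszul_d M x ys b T)"
    by blast
qed

text \<open>The connecting homomorphism for \<open>0 \<rightarrow> ker f \<rightarrow> P \<rightarrow> f ` P \<rightarrow> 0\<close>.\<close>

lemma koszul_exact_image:
  assumes P: "module R P" and N: "module R N" and f: "f \<in> module_hom R P N"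
    and x: "x ` set ys \<subseteq> carrier R"
    and P_exact: "koszul_exact P x ys (carrier P) i"
    and ker_exact: "koszul_exact P x ys (module_kernel P N f) (Suc i)"
  shows "koszul_exact N x ys (f ` carrier P) i"
  unfolding koszul_exact_def
proof (intro allI impI)
  interpret P: module R P by fact
  interpret N: module R N by fact
  fix c assume c: "range c \<subseteq> f ` carrier P \<and>
      (\<forall>T\<subseteq>set ys. card T = Suc i \<longrightarrow> koszul_d N x ys c T = \<zero>\<^bsub>N\<^esub>)"
  have fP: "f u \<in> carrier N" if "u \<in> carrier P" for u using f that unfolding module_hom_def by auto
  have "\<forall>U. \<exists>u\<in>carrier P. c U = f u" using c by blast
  then obtain l where l: "\<And>U. l U \<in> carrier P" "\<And>U. c U = f (l U)" by metis
  have lr: "range l \<subseteq> carrier P" using l by auto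
  \<comment> \<open>The coboundary of the lift, cut off outside the relevant degree: all values have
    to lie in the kernel of \<open>f\<close>, and only in that degree is this known for the
    coboundary.\<close>
  define k where
    "k T = (if T \<subseteq> set ys \<and> card T = Suc i then koszul_d P x ys l T else \<zero>\<^bsub>P\<^esub>)" for T
  have "k T \<in> module_kernel P N f" for T
  proof (cases "T \<subseteq> set ys \<and> card T = Suc i")
    case True
    have "koszul_d N x ys c T = \<zero>\<^bsub>N\<^esub>" using c True by blast
    then have "f (koszul_d P x ys l T) = \<zero>\<^bsub>N\<^esub>"
      using koszul_d_hom[OF P N f x lr, of T] by (simp add: l(2)[symmetric])
    then show ?thesis
      using True P.koszul_d_closed[OF x lr] by (simp add: k_def module_kernel_def)
  next
    case False
    then show ?thesis using module_hom_zero[OF P N f] by (auto simp: k_def module_kernel_def)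
  qed
  moreover have "koszul_d P x ys k T = \<zero>\<^bsub>P\<^esub>" if T: "T \<subseteq> set ys" "card T = Suc (Suc i)" for T
  proof -
    have "koszul_d P x ys k T = koszul_d P x ys (koszul_d P x ys l) T"
      by (rule koszul_d_cong) (use T in \<open>auto simp: k_def\<close>)
    then show ?thesis using P.koszul_d_d[OF x lr] by simp
  qed
  ultimately obtain e where e: "range e \<subseteq> module_kernel P N f"
    and ke: "\<And>T. T \<subseteq> set ys \<Longrightarrow> card T = Suc i \<Longrightarrow> k T = koszul_d P x ys e T"
    using ker_exact unfolding koszul_exact_def by blast
  have eP: "e U \<in> carrier P" "f (e U) = \<zero>\<^bsub>N\<^esub>" for U using e unfolding module_kernel_def by auto
  have er: "range e \<subseteq> carrier P" using eP by auto
  \<comment> \<open>Subtracting \<open>e\<close> turns the lift into a cocycle without changing its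
    image, since \<open>f\<close> kills \<open>e\<close>.\<close>
  have "koszul_d P x ys (\<lambda>U. l U \<ominus>\<^bsub>P\<^esub> e U) T = \<zero>\<^bsub>P\<^esub>" if "T \<subseteq> set ys" "card T = Suc i" for T
  proof -
    have "koszul_d P x ys e T = koszul_d P x ys l T" using ke[OF that] that by (simp add: k_def)
    then show ?thesis
      using P.koszul_d_minus[OF x lr er] P.koszul_d_closed[OF x lr]
      by (simp add: P.M.minus_eq P.M.r_neg)
  qed
  moreover have "range (\<lambda>U. l U \<ominus>\<^bsub>P\<^esub> e U) \<subseteq> carrier P" using l eP by auto
  ultimately obtain b where b: "range b \<subseteq> carrier P"
    and lb: "\<And>T. T \<subseteq> set ys \<Longrightarrow> card T = i \<Longrightarrow> l T \<ominus>\<^bsub>P\<^esub> e T = koszul_d P x ys b T"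
    using P_exact[unfolded koszul_exact_def, rule_format, of "\<lambda>U. l U \<ominus>\<^bsub>P\<^esub> e U"] by blast
  have "c T = koszul_d N x ys (\<lambda>U. f (b U)) T" if "T \<subseteq> set ys" "card T = i" for T
  proof -
    have "c T = f (l T \<ominus>\<^bsub>P\<^esub> e T)"
      using module_hom_minus[OF P N f] l eP fP by (simp add: N.M.minus_eq N.M.a_inv_zero)
    also have "\<dots> = koszul_d N x ys (\<lambda>U. f (b U)) T"
      using koszul_d_hom[OF P N f x b, of T] lb[OF that] by simp
    finally show ?thesis .
  qed
  moreover have "range (\<lambda>U. f (b U)) \<subseteq> f ` carrier P" using b by auto
  ultimately show
    "\<exists>b. range b \<subseteq> f ` carrier P \<and> (\<forall>T\<subseteq>set ys. card T = i \<longrightarrow> c T = koszul_d N x ys b T)"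
    by blast
qed

lemma koszul_exact_trivial:
  assumes "module R M" "x ` set ys \<subseteq> carrier R"
  shows "koszul_exact M x ys {\<zero>\<^bsub>M\<^esub>} i"
proof -
  interpret module R M by fact
  have "c T = koszul_d M x ys (\<lambda>U. \<zero>\<^bsub>M\<^esub>) T" if "range c \<subseteq> {\<zero>\<^bsub>M\<^esub>}" for c T
    using that koszul_d_zero[OF assms(2)] by auto
  then show ?thesis
    unfolding koszul_exact_def by (intro allI impI exI[of _ "\<lambda>U. \<zero>\<^bsub>M\<^esub>"]) auto
qed

text \<open>Downward induction on \<open>q\<close>: degree \<open>i + q + 2\<close> for the image
  inside \<open>P (Suc q)\<close> gives degree \<open>i + q + 1\<close> for the image inside
  \<open>P q\<close>, starting from the zero image at \<open>q = l\<close>. The highest degree in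
  which a \<open>P q\<close> itself must be exact is \<open>i + l\<close>, attained at
  \<open>q = l\<close>; hence the bound by \<open>length ys\<close>.\<close>

lemma projective_resolution_koszul_exact:
  assumes res: "projective_resolution R M P \<delta> \<epsilon>" and M: "module R M"
    and l: "\<And>i. i > l \<Longrightarrow> carrier (P i) = {\<zero>\<^bsub>P i\<^esub>}"
    and x: "x ` set ys \<subseteq> carrier R"
    and exact: "\<And>q i. i < length ys \<Longrightarrow> koszul_exact (P q) x ys (carrier (P q)) i"
    and i: "i + l < length ys"
  shows "koszul_exact M x ys (carrier M) i"
proof -
  have P: "module R (P q)" for q
    using res unfolding projective_resolution_def projective_module_def by auto
  have \<delta>: "\<delta> q \<in> module_hom R (P (Suc q)) (P q)" for q
    using res unfolding projective_resolution_def by auto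
  have im: "koszul_exact (P q) x ys (\<delta> q ` carrier (P (Suc q))) (Suc (i + q))" if "q \<le> l" for q
    using that
  proof (induction rule: inc_induct)
    case base
    have "\<delta> l ` carrier (P (Suc l)) = {\<zero>\<^bsub>P l\<^esub>}"
      using l[of "Suc l"] module_hom_zero[OF P P \<delta>[of l]] by simp
    then show ?case using koszul_exact_trivial[OF P x] by simp
  next
    case (step q)
    have "\<delta> (Suc q) ` carrier (P (Suc (Suc q))) = module_kernel (P (Suc q)) (P q) (\<delta> q)"
      using res unfolding projective_resolution_def by auto
    then show ?case
      using koszul_exact_image[OF P P \<delta>[of q] x exact, of "Suc (i + q)"] step i by simp
  qed
  have "koszul_exact M x ys (\<epsilon> ` carrier (P 0)) i"
  proof (rule koszul_exact_image[OF P M _ x exact])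
    show "\<epsilon> \<in> module_hom R (P 0) M" using res unfolding projective_resolution_def by auto
    show "i < length ys" using i by simp
    have "\<delta> 0 ` carrier (P 1) = module_kernel (P 0) M \<epsilon>"
      using res unfolding projective_resolution_def by auto
    then show "koszul_exact (P 0) x ys (module_kernel (P 0) M \<epsilon>) (Suc i)" using im[of 0] by simp
  qed
  then show ?thesis using res unfolding projective_resolution_def by simp
qed

text \<open>A finite infimum of extended naturals excludes the empty set and is therefore
  attained.\<close>

lemma projective_dimension_enatE:
  assumes "projective_dimension R (M :: ('a, 'm) module) = enat p"
  obtains P :: "nat \<Rightarrow> ('a, nat \<times> 'a \<times> 'm \<Rightarrow> 'a) module" and \<delta> \<epsilon> where
    "projective_resolution R M P \<delta> \<epsilon>" "\<And>i. i > p \<Longrightarrow> carrier (P i) = {\<zero>\<^bsub>P i\<^esub>}"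
proof -
  define L where "L = {enat l | l.
     \<exists>(P :: nat \<Rightarrow> ('a, nat \<times> 'a \<times> 'm \<Rightarrow> 'a) module) \<delta> \<epsilon>.
        projective_resolution R M P \<delta> \<epsilon> \<and> (\<forall>i>l. carrier (P i) = {\<zero>\<^bsub>P i\<^esub>})}"
  have L: "Inf L = enat p" using assms unfolding L_def projective_dimension_def .
  then have "L \<noteq> {}" by (auto simp: Inf_enat_def)
  then have "Inf L \<in> L" by (meson ex_in_conv wellorder_InfI)
  then have "enat p \<in> L" using L by simp
  then obtain P :: "nat \<Rightarrow> ('a, nat \<times> 'a \<times> 'm \<Rightarrow> 'a) module" and \<delta> \<epsilon> where
    "projective_resolution R M P \<delta> \<epsilon>" "\<forall>i>p. carrier (P i) = {\<zero>\<^bsub>P i\<^esub>}"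
    unfolding L_def by auto
  then show ?thesis using that by blast
qed

section \<open>Regularity of the variables on free modules\<close>

lemma lookup_single_mult_add:
  fixes f :: "(nat \<Rightarrow>\<^sub>0 nat) \<Rightarrow>\<^sub>0 'k::field"
  shows "Poly_Mapping.lookup (Poly_Mapping.single m c * f) (m + k) = c * Poly_Mapping.lookup f k"
  by (simp add: lookup_mult lookup_single when_mult)

lemma lookup_single_mult_other:
  fixes f :: "(nat \<Rightarrow>\<^sub>0 nat) \<Rightarrow>\<^sub>0 'k::field"
  assumes "\<And>k. l \<noteq> m + k"
  shows "Poly_Mapping.lookup (Poly_Mapping.single m c * f) l = 0"
  using assms by (simp add: lookup_mult lookup_single when_mult)

lemma keys_plus_nat: "Poly_Mapping.keys (m + m' :: nat \<Rightarrow>\<^sub>0 nat) = Poly_Mapping.keys m \<union> Poly_Mapping.keys m'"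
  by (auto simp: in_keys_iff lookup_add)

lemma poly_mapping_minus_single_add:
  assumes "y \<in> Poly_Mapping.keys (m :: nat \<Rightarrow>\<^sub>0 nat)"
  shows "Poly_Mapping.single y 1 + (m - Poly_Mapping.single y 1) = m"
  using assms
  by (intro poly_mapping_eqI) (auto simp: lookup_add lookup_minus lookup_single when_def in_keys_iff)

lemma poly_mult_keysE:
  fixes f g :: "(nat \<Rightarrow>\<^sub>0 nat) \<Rightarrow>\<^sub>0 'k::field"
  assumes "m \<in> Poly_Mapping.keys (f * g)"
  obtains a b where "a \<in> Poly_Mapping.keys f" "b \<in> Poly_Mapping.keys g"
    "Poly_Mapping.keys m = Poly_Mapping.keys a \<union> Poly_Mapping.keys b"
  using assms keys_mult[of f g] keys_plus_nat by blast

lemma poly_ring_simps [simp]: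
  "\<zero>\<^bsub>poly_ring n\<^esub> = 0" "\<one>\<^bsub>poly_ring n\<^esub> = 1" "a \<oplus>\<^bsub>poly_ring n\<^esub> b = a + b"
  "a \<otimes>\<^bsub>poly_ring n\<^esub> b = a * b"
  by (simp_all add: poly_ring_def)

lemma poly_ring_carrier_iff:
  "f \<in> carrier (poly_ring n) \<longleftrightarrow> (\<forall>m\<in>Poly_Mapping.keys f. Poly_Mapping.keys m \<subseteq> {1..n})"
  by (simp add: poly_ring_def)

lemma poly_ring_closed:
  fixes f g :: "('k::field) mpoly"
  shows "0 \<in> carrier (poly_ring n)" "1 \<in> carrier (poly_ring n)"
    "f \<in> carrier (poly_ring n) \<Longrightarrow> g \<in> carrier (poly_ring n) \<Longrightarrow> f + g \<in> carrier (poly_ring n)"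
    "f \<in> carrier (poly_ring n) \<Longrightarrow> g \<in> carrier (poly_ring n) \<Longrightarrow> f * g \<in> carrier (poly_ring n)"
    "f \<in> carrier (poly_ring n) \<Longrightarrow> - f \<in> carrier (poly_ring n)"
proof -
  show "0 \<in> carrier (poly_ring n)" "1 \<in> carrier (poly_ring n)" by (auto simp: poly_ring_carrier_iff)
  show "f + g \<in> carrier (poly_ring n)" if "f \<in> carrier (poly_ring n)" "g \<in> carrier (poly_ring n)"
    using that keys_add[of f g] by (auto simp: poly_ring_carrier_iff)
  show "f * g \<in> carrier (poly_ring n)" if "f \<in> carrier (poly_ring n)" "g \<in> carrier (poly_ring n)"
    unfolding poly_ring_carrier_iff
  proof
    fix m assume "m \<in> Poly_Mapping.keys (f * g)"
    then show "Poly_Mapping.keys m \<subseteq> {1..n}"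
      by (rule poly_mult_keysE) (use that in \<open>auto simp: poly_ring_carrier_iff\<close>)
  qed
  show "- f \<in> carrier (poly_ring n)" if "f \<in> carrier (poly_ring n)"
    using that by (auto simp: poly_ring_carrier_iff in_keys_iff)
qed

lemma poly_ring_cring: "cring (poly_ring n :: ('k::field) mpoly ring)"
proof (rule cringI)
  show "abelian_group (poly_ring n :: 'k mpoly ring)"
  proof (rule abelian_groupI)
    show "\<exists>y\<in>carrier (poly_ring n). y \<oplus>\<^bsub>poly_ring n\<^esub> x = \<zero>\<^bsub>poly_ring n\<^esub>"
      if "x \<in> carrier (poly_ring n)" for x :: "'k mpoly"
      using poly_ring_closed(5)[OF that] by (intro bexI[of _ "- x"]) auto
  qed (auto simp: poly_ring_closed algebra_simps)
  show "comm_monoid (poly_ring n :: 'k mpoly ring)"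
    by (rule comm_monoidI) (auto simp: poly_ring_closed algebra_simps)
qed (auto simp: algebra_simps)

lemma poly_var_closed: "i \<in> {1..n} \<Longrightarrow> poly_var i \<in> carrier (poly_ring n)"
  by (simp add: poly_ring_carrier_iff poly_var_def)

lemma poly_var_image_closed: "A \<subseteq> {1..n} \<Longrightarrow> poly_var ` A \<subseteq> carrier (poly_ring n)"
  using poly_var_closed by blast

lemma lookup_poly_var_mult:
  "Poly_Mapping.lookup (poly_var y * f) m =
     (if y \<in> Poly_Mapping.keys m then Poly_Mapping.lookup f (m - Poly_Mapping.single y 1) else 0)"
proof (cases "y \<in> Poly_Mapping.keys m")
  case True
  then show ?thesis
    using lookup_single_mult_add[of "Poly_Mapping.single y 1" 1 f "m - Poly_Mapping.single y 1"]
      poly_mapping_minus_single_add[OF True] by (simp add: poly_var_def)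
next
  case False
  then have "m \<noteq> Poly_Mapping.single y 1 + k" for k by (auto simp: keys_plus_nat)
  then show ?thesis
    using False lookup_single_mult_other[of m "Poly_Mapping.single y 1" 1 f] by (simp add: poly_var_def)
qed

lemma keys_poly_var_mult:
  assumes "m \<in> Poly_Mapping.keys f"
  shows "Poly_Mapping.single y 1 + m \<in> Poly_Mapping.keys (poly_var y * f)"
  using assms lookup_single_mult_add[of "Poly_Mapping.single y 1" 1 f m]
  by (simp add: in_keys_iff poly_var_def)

text \<open>Together with \<open>var_rem\<close> this is division by the variable \<open>y\<close>:
  the quotient collects the terms divisible by \<open>y\<close> with one factor removed, the
  remainder the terms free of \<open>y\<close>.\<close>

definition var_quot :: "nat \<Rightarrow> ('k::field) mpoly \<Rightarrow> 'k mpoly" where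
  "var_quot y = Poly_Mapping.map_key (\<lambda>m. Poly_Mapping.single y 1 + m)"

definition var_rem :: "nat \<Rightarrow> ('k::field) mpoly \<Rightarrow> 'k mpoly" where
  "var_rem y f = f - poly_var y * var_quot y f"

lemma lookup_var_quot:
  "Poly_Mapping.lookup (var_quot y f) m = Poly_Mapping.lookup f (Poly_Mapping.single y 1 + m)"
  unfolding var_quot_def by (subst map_key.rep_eq) (auto intro: injI)

lemma lookup_var_rem:
  "Poly_Mapping.lookup (var_rem y f) m
     = (if y \<in> Poly_Mapping.keys m then 0 else Poly_Mapping.lookup f m)"
  using poly_mapping_minus_single_add[of y m]
  by (simp add: var_rem_def lookup_minus lookup_poly_var_mult lookup_var_quot)

lemma var_quot_closed:
  assumes "f \<in> carrier (poly_ring n)"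
  shows "var_quot y f \<in> carrier (poly_ring n)"
  unfolding poly_ring_carrier_iff
proof
  fix m assume "m \<in> Poly_Mapping.keys (var_quot y f)"
  then have "Poly_Mapping.single y 1 + m \<in> Poly_Mapping.keys f"
    by (simp add: in_keys_iff lookup_var_quot)
  then have "Poly_Mapping.keys (Poly_Mapping.single y 1 + m) \<subseteq> {1..n}"
    using assms unfolding poly_ring_carrier_iff by blast
  then show "Poly_Mapping.keys m \<subseteq> {1..n}" by (simp add: keys_plus_nat)
qed

lemma var_rem_closed:
  assumes "f \<in> carrier (poly_ring n)"
  shows "var_rem y f \<in> carrier (poly_ring n)"
  using assms by (auto simp: poly_ring_carrier_iff in_keys_iff lookup_var_rem split: if_splits)

section \<open>Koszul complexes of variables over free modules\<close>

lemma free_module_simps: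
  "\<zero>\<^bsub>free_module R B\<^esub> = (\<lambda>b. \<zero>\<^bsub>R\<^esub>)" "f \<oplus>\<^bsub>free_module R B\<^esub> g = (\<lambda>b. f b \<oplus>\<^bsub>R\<^esub> g b)"
  "a \<odot>\<^bsub>free_module R B\<^esub> f = (\<lambda>b. a \<otimes>\<^bsub>R\<^esub> f b)"
  by (simp_all add: free_module_def)

lemma free_module_module:
  assumes "cring R"
  shows "module R (free_module R B)"
proof -
  interpret cring R by fact
  \<comment> \<open>One support argument for sums, scalar multiples and negatives; in the unary
    cases \<open>g\<close> repeats \<open>f\<close>.\<close>
  have fin: "finite {b. h b \<noteq> \<zero>\<^bsub>R\<^esub>} \<and> {b. h b \<noteq> \<zero>\<^bsub>R\<^esub>} \<subseteq> B"
    if "\<And>b. f b = \<zero>\<^bsub>R\<^esub> \<Longrightarrow> g b = \<zero>\<^bsub>R\<^esub> \<Longrightarrow> h b = \<zero>\<^bsub>R\<^esub>" 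
      "finite {b. f b \<noteq> \<zero>\<^bsub>R\<^esub>}" "finite {b. g b \<noteq> \<zero>\<^bsub>R\<^esub>}"
      "{b. f b \<noteq> \<zero>\<^bsub>R\<^esub>} \<subseteq> B" "{b. g b \<noteq> \<zero>\<^bsub>R\<^esub>} \<subseteq> B" for f g h
  proof -
    have *: "{b. h b \<noteq> \<zero>\<^bsub>R\<^esub>} \<subseteq> {b. f b \<noteq> \<zero>\<^bsub>R\<^esub>} \<union> {b. g b \<noteq> \<zero>\<^bsub>R\<^esub>}" using that(1) by blast
    show ?thesis using that(2-) finite_subset[OF *] * by blast
  qed
  have add: "(\<lambda>b. f b \<oplus>\<^bsub>R\<^esub> g b) \<in> carrier (free_module R B)"
    if "f \<in> carrier (free_module R B)" "g \<in> carrier (free_module R B)" for f g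
    using that fin[of f g "\<lambda>b. f b \<oplus>\<^bsub>R\<^esub> g b"] by (auto simp: free_module_def)
  have smult: "(\<lambda>b. a \<otimes>\<^bsub>R\<^esub> f b) \<in> carrier (free_module R B)"
    if "a \<in> carrier R" "f \<in> carrier (free_module R B)" for a f
    using that fin[of f f "\<lambda>b. a \<otimes>\<^bsub>R\<^esub> f b"] by (auto simp: free_module_def)
  have inv: "(\<lambda>b. \<ominus>\<^bsub>R\<^esub> f b) \<in> carrier (free_module R B)"
    if "f \<in> carrier (free_module R B)" for f
    using that fin[of f f "\<lambda>b. \<ominus>\<^bsub>R\<^esub> f b"] by (auto simp: free_module_def)
  have zero: "(\<lambda>b. \<zero>\<^bsub>R\<^esub>) \<in> carrier (free_module R B)" by (simp add: free_module_def)
  have mem: "f b \<in> carrier R" if "f \<in> carrier (free_module R B)" for f b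
    using that by (auto simp: free_module_def)
  note ops = free_module_simps[where R = R and B = B]
  show ?thesis
  proof (rule moduleI)
    show "abelian_group (free_module R B)"
    proof (rule abelian_groupI)
      show "\<exists>g\<in>carrier (free_module R B). g \<oplus>\<^bsub>free_module R B\<^esub> f = \<zero>\<^bsub>free_module R B\<^esub>"
        if "f \<in> carrier (free_module R B)" for f
        using inv[OF that] mem[OF that] by (intro bexI[of _ "\<lambda>b. \<ominus>\<^bsub>R\<^esub> f b"]) (auto simp: ops l_neg)
    qed (auto simp: ops add zero mem a_ac)
  qed (auto simp: ops smult mem l_distr r_distr m_assoc assms)
qed

text \<open>For \<open>W\<close> a set of variables, this is \<open>(W) F\<close> for the free module \<open>F\<close> on \<open>B\<close>.\<close>

definition var_submodule :: "nat \<Rightarrow> 'b set \<Rightarrow> nat set \<Rightarrow> ('b \<Rightarrow> ('k::field) mpoly) set" where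
  "var_submodule n B W = {f \<in> carrier (free_module (poly_ring n) B).
     \<forall>b. \<forall>m\<in>Poly_Mapping.keys (f b). Poly_Mapping.keys m \<inter> W \<noteq> {}}"

lemma var_submodule_submodule:
  "submodule (var_submodule n B W) (poly_ring n) (free_module (poly_ring n :: ('k::field) mpoly ring) B)"
proof -
  let ?R = "poly_ring n :: 'k mpoly ring"
  let ?F = "free_module ?R B"
  interpret F: module ?R ?F by (rule free_module_module[OF poly_ring_cring])
  have smult: "a \<odot>\<^bsub>?F\<^esub> f \<in> var_submodule n B W"
    if "a \<in> carrier ?R" "f \<in> var_submodule n B W" for a f
  proof -
    have f: "f \<in> carrier ?F" using that by (simp add: var_submodule_def)
    have "Poly_Mapping.keys m \<inter> W \<noteq> {}" if "m \<in> Poly_Mapping.keys (a * f b)" for b m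
      using that
    proof (rule poly_mult_keysE)
      fix u v assume "v \<in> Poly_Mapping.keys (f b)"
        "Poly_Mapping.keys m = Poly_Mapping.keys u \<union> Poly_Mapping.keys v"
      then show ?thesis using \<open>f \<in> var_submodule n B W\<close> by (auto simp: var_submodule_def)
    qed
    then show ?thesis
      using F.smult_closed[OF that(1) f] unfolding var_submodule_def by (simp add: free_module_simps)
  qed
  show ?thesis
  proof (rule F.submoduleI)
    show "\<zero>\<^bsub>?F\<^esub> \<in> var_submodule n B W"
      using F.M.zero_closed by (simp add: var_submodule_def free_module_simps)
    show "f \<oplus>\<^bsub>?F\<^esub> g \<in> var_submodule n B W"
      if "f \<in> var_submodule n B W" "g \<in> var_submodule n B W" for f g
    proof -
      have "f \<in> carrier ?F" "g \<in> carrier ?F" using that by (auto simp: var_submodule_def)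
      then have "f \<oplus>\<^bsub>?F\<^esub> g \<in> carrier ?F" by simp
      moreover have "Poly_Mapping.keys m \<inter> W \<noteq> {}" if "m \<in> Poly_Mapping.keys (f b + g b)" for b m
        using that keys_add[of "f b" "g b"] \<open>f \<in> var_submodule n B W\<close> \<open>g \<in> var_submodule n B W\<close>
        by (auto simp: var_submodule_def)
      ultimately show ?thesis by (simp add: var_submodule_def free_module_simps)
    qed
    show "\<ominus>\<^bsub>?F\<^esub> f \<in> var_submodule n B W" if "f \<in> var_submodule n B W" for f
    proof -
      have "f \<in> carrier ?F" using that by (simp add: var_submodule_def)
      then have "\<ominus>\<^bsub>?F\<^esub> f = (\<ominus>\<^bsub>?R\<^esub> \<one>\<^bsub>?R\<^esub>) \<odot>\<^bsub>?F\<^esub> f"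
        using F.smult_l_minus[OF F.R.one_closed, of f] F.smult_one[of f] by simp
      then show ?thesis using smult[OF F.R.a_inv_closed[OF F.R.one_closed] that] by simp
    qed
    show "var_submodule n B W \<subseteq> carrier ?F" by (auto simp: var_submodule_def)
  qed (rule smult)
qed

text \<open>Every term of the differential carries a variable from the list. With the converse in
  \<open>var_submodule_koszul_d\<close>, the image of the last differential becomes a condition on
  single monomials.\<close>

lemma koszul_d_free_module:
  fixes c :: "nat set \<Rightarrow> 'b \<Rightarrow> ('k::field) mpoly"
  assumes "set ys \<subseteq> {1..n}" "range c \<subseteq> carrier (free_module (poly_ring n) B)"
  shows "koszul_d (free_module (poly_ring n) B) poly_var ys c T \<in> var_submodule n B (set ys)"
  using assms
proof (induction ys arbitrary: c T)
  case Nil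
  interpret F: module "poly_ring n :: 'k mpoly ring" "free_module (poly_ring n :: 'k mpoly ring) B"
    by (rule free_module_module[OF poly_ring_cring])
  show ?case
    using F.M.zero_closed by (simp add: var_submodule_def free_module_simps)
next
  case (Cons y ys)
  let ?F = "free_module (poly_ring n :: 'k mpoly ring) B"
  interpret F: module "poly_ring n :: 'k mpoly ring" ?F
    by (rule free_module_module[OF poly_ring_cring])
  have mono: "var_submodule n B (set ys) \<subseteq> var_submodule n B (set (y # ys))"
    unfolding var_submodule_def by auto
  have c: "c U \<in> carrier ?F" for U using Cons.prems by auto
  have y: "poly_var y \<in> carrier (poly_ring n :: 'k mpoly ring)" using Cons.prems poly_var_closed by auto
  have "poly_var y \<odot>\<^bsub>?F\<^esub> c U \<in> var_submodule n B (set (y # ys))" for U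
    using F.smult_closed[OF y c]
    by (auto simp: var_submodule_def free_module_simps in_keys_iff lookup_poly_var_mult split: if_splits)
  moreover have "koszul_d ?F poly_var ys (\<lambda>U. c (insert y U)) V \<in> var_submodule n B (set (y # ys))" for V
    using Cons.IH[of "\<lambda>U. c (insert y U)" V] Cons.prems mono by auto
  moreover have "koszul_d ?F poly_var ys c V \<in> var_submodule n B (set (y # ys))" for V
    using Cons.IH[of c V] Cons.prems mono by auto
  ultimately show ?case
    using F.submoduleE(3,5)[OF var_submodule_submodule[of n B "set (y # ys)"]]
    by (auto simp: F.M.minus_eq simp del: set_simps)
qed

text \<open>Divide each coordinate by \<open>y\<close>. The quotient becomes the value of the
  cochain at \<open>set ys\<close>; the monomials of the remainder are free of \<open>y\<close>,
  hence still meet \<open>set ys\<close>, and induction applies to them.\<close>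

lemma var_submodule_koszul_d:
  fixes f :: "'b \<Rightarrow> ('k::field) mpoly"
  assumes "set ys \<subseteq> {1..n}" "distinct ys" "f \<in> var_submodule n B (set ys)"
  shows "\<exists>c. range c \<subseteq> carrier (free_module (poly_ring n) B)
    \<and> f = koszul_d (free_module (poly_ring n) B) poly_var ys c (set ys)"
  using assms
proof (induction ys arbitrary: f)
  case Nil
  let ?F = "free_module (poly_ring n :: 'k mpoly ring) B"
  interpret F: module "poly_ring n :: 'k mpoly ring" ?F
    by (rule free_module_module[OF poly_ring_cring])
  have "\<And>b. f b = 0" using Nil by (auto simp: var_submodule_def)
  then have "f = \<zero>\<^bsub>?F\<^esub>" by (auto simp: free_module_simps)
  then show ?case by (intro exI[of _ "\<lambda>_. \<zero>\<^bsub>?F\<^esub>"]) auto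
next
  case (Cons y ys)
  let ?F = "free_module (poly_ring n :: 'k mpoly ring) B"
  interpret F: module "poly_ring n :: 'k mpoly ring" ?F
    by (rule free_module_module[OF poly_ring_cring])
  have f: "f \<in> carrier ?F" using Cons.prems by (simp add: var_submodule_def)
  then have fb: "f b \<in> carrier (poly_ring n)" for b by (simp add: free_module_def)
  \<comment> \<open>Quotient and remainder vanish wherever \<open>f\<close> does and so inherit its
    finite support.\<close>
  have sub: "carrier ?F \<supseteq> {h. (\<forall>b. h b \<in> carrier (poly_ring n)) \<and> (\<forall>b. f b = 0 \<longrightarrow> h b = 0)}"
  proof safe
    fix h :: "'b \<Rightarrow> 'k mpoly" assume h: "\<forall>b. h b \<in> carrier (poly_ring n)" "\<forall>b. f b = 0 \<longrightarrow> h b = 0"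
    then have "{b. h b \<noteq> 0} \<subseteq> {b. f b \<noteq> 0}" by auto
    then show "h \<in> carrier ?F" using f h finite_subset by (auto simp: free_module_def)
  qed
  define q where "q b = var_quot y (f b)" for b
  define r where "r b = var_rem y (f b)" for b
  have quot0: "var_quot y 0 = (0 :: 'k mpoly)" by (intro poly_mapping_eqI) (simp add: lookup_var_quot)
  have q: "q \<in> carrier ?F"
    by (rule subsetD[OF sub]) (auto simp: q_def var_quot_closed fb quot0)
  have r: "r \<in> carrier ?F"
    by (rule subsetD[OF sub]) (auto simp: r_def var_rem_closed fb quot0 var_rem_def[of y 0])
  have "m \<in> Poly_Mapping.keys (f b) \<and> y \<notin> Poly_Mapping.keys m" if "m \<in> Poly_Mapping.keys (r b)" for m b
    using that by (simp add: r_def in_keys_iff lookup_var_rem split: if_splits)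
  then have "r \<in> var_submodule n B (set ys)"
    using Cons.prems(3) r by (fastforce simp: var_submodule_def)
  then obtain c where c: "range c \<subseteq> carrier ?F" "r = koszul_d ?F poly_var ys c (set ys)"
    using Cons.IH[of r] Cons.prems by auto
  have cF: "c U \<in> carrier ?F" for U using c by auto
  have y: "poly_var y \<in> carrier (poly_ring n :: 'k mpoly ring)" and yn: "y \<notin> set ys"
    and ys: "poly_var ` set ys \<subseteq> carrier (poly_ring n :: 'k mpoly ring)"
    using Cons.prems poly_var_closed[of y n] poly_var_image_closed[of "set ys" n] by simp_all
  \<comment> \<open>The sign of the \<open>c\<close> part compensates the subtraction in the
    recursion of \<open>koszul_d\<close>.\<close>
  define g where "g U = (if y \<in> U then \<ominus>\<^bsub>?F\<^esub> c (U - {y}) else q)" for U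
  have "koszul_d ?F poly_var ys (\<lambda>U. g (insert y U)) (set ys)
      = koszul_d ?F poly_var ys (\<lambda>U. \<ominus>\<^bsub>?F\<^esub> c U) (set ys)"
    by (rule koszul_d_cong) (use yn in \<open>auto simp: g_def\<close>)
  also have "\<dots> = \<ominus>\<^bsub>?F\<^esub> r" using F.koszul_d_uminus[OF ys c(1)] c(2) by simp
  finally have "koszul_d ?F poly_var (y # ys) g (set (y # ys)) = poly_var y \<odot>\<^bsub>?F\<^esub> q \<oplus>\<^bsub>?F\<^esub> r"
    using yn q r y by (simp add: g_def F.M.minus_eq)
  also have "\<dots> = f" by (auto simp: free_module_simps q_def r_def var_rem_def)
  finally have "f = koszul_d ?F poly_var (y # ys) g (set (y # ys))" by simp
  moreover have "range g \<subseteq> carrier ?F" using q cF by (auto simp: g_def)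
  ultimately show ?case by blast
qed

text \<open>As \<open>y\<close> is not in \<open>ys\<close>, multiplying a monomial by it does not
  affect whether the monomial involves a variable from \<open>ys\<close>. Membership in the
  submodule is decided monomial by monomial, so \<open>y\<close> can be cancelled.\<close>

lemma free_module_koszul_regular:
  assumes "set ys \<subseteq> {1..n}" "distinct ys"
  shows "koszul_regular (free_module (poly_ring n :: ('k::field) mpoly ring) B) poly_var ys"
  using assms
proof (induction ys)
  case (Cons y ys)
  let ?F = "free_module (poly_ring n :: 'k mpoly ring) B"
  have "\<exists>b'. range b' \<subseteq> carrier ?F \<and> a = koszul_d ?F poly_var ys b' (set ys)"
    if a: "a \<in> carrier ?F" and b: "range b \<subseteq> carrier ?F"
      and ab: "poly_var y \<odot>\<^bsub>?F\<^esub> a = koszul_d ?F poly_var ys b (set ys)" for a b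
  proof -
    have "poly_var y \<odot>\<^bsub>?F\<^esub> a \<in> var_submodule n B (set ys)"
      unfolding ab by (rule koszul_d_free_module) (use Cons.prems b in auto)
    then have mem: "Poly_Mapping.keys m \<inter> set ys \<noteq> {}" if "m \<in> Poly_Mapping.keys (poly_var y * a z)" for m z
      using that by (auto simp: var_submodule_def free_module_simps)
    have "Poly_Mapping.keys m \<inter> set ys \<noteq> {}" if "m \<in> Poly_Mapping.keys (a z)" for m z
      using mem[OF keys_poly_var_mult[OF that, of y]] Cons.prems by (auto simp: keys_plus_nat)
    then have "a \<in> var_submodule n B (set ys)" using a by (simp add: var_submodule_def)
    then show ?thesis using var_submodule_koszul_d[of ys n a B] Cons.prems by simp
  qed
  moreover have "koszul_regular ?F poly_var ys" using Cons by simp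
  ultimately show ?case by (simp only: koszul_regular.simps) blast
qed simp

lemma projective_module_koszul_exact:
  fixes P :: "(('k::field) mpoly, 'm) module"
  assumes "projective_module (poly_ring n) P"
    and "set ys \<subseteq> {1..n}" "distinct ys" "i < length ys"
  shows "koszul_exact P poly_var ys (carrier P) i"
proof -
  let ?R = "poly_ring n :: 'k mpoly ring"
  obtain B :: "'m set" and \<iota> \<pi> where P: "module ?R P" and hom: "\<iota> \<in> module_hom ?R P (free_module ?R B)"
      "\<pi> \<in> module_hom ?R (free_module ?R B) P" and id: "\<forall>u\<in>carrier P. \<pi> (\<iota> u) = u"
    using assms(1) unfolding projective_module_def by blast
  have F: "module ?R (free_module ?R B)" by (rule free_module_module[OF poly_ring_cring])
  have x: "poly_var ` set ys \<subseteq> carrier ?R" using assms(2) poly_var_image_closed by blast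
  have "koszul_exact (free_module ?R B) poly_var ys (carrier (free_module ?R B)) i"
    using module.koszul_regular_exact[OF F free_module_koszul_regular[OF assms(2,3)] x assms(3,4)] .
  then show ?thesis using koszul_exact_retract[OF P F hom _ x] id by simp
qed

section \<open>Stanley--Reisner modules\<close>

lemma poly_ring_uminus:
  fixes g :: "('k::field) mpoly"
  assumes "g \<in> carrier (poly_ring n)"
  shows "\<ominus>\<^bsub>poly_ring n\<^esub> g = - g"
proof -
  interpret cring "poly_ring n :: 'k mpoly ring" by (rule poly_ring_cring)
  show ?thesis
    using minus_equality[of "- g" g] assms poly_ring_closed(5)[OF assms] by simp
qed

lemma prod_poly_var:
  assumes "finite F"
  shows "(\<Prod>i\<in>F. poly_var i) = (Poly_Mapping.single (\<Sum>i\<in>F. Poly_Mapping.single i 1) 1 :: ('k::field) mpoly)"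
  using assms by (induction F) (auto simp: poly_var_def mult_single)

lemma keys_sum_single:
  fixes F :: "nat set"
  assumes "finite F"
  shows "Poly_Mapping.keys (\<Sum>i\<in>F. Poly_Mapping.single i (1::nat)) = F"
  using assms by (induction F) (auto simp: keys_plus_nat)

lemma SR_ideal_ideal: "ideal (SR_ideal n \<Delta> :: ('k::field) mpoly set) (poly_ring n)"
  and SR_ideal_generator:
    "F \<subseteq> {1..n} \<Longrightarrow> F \<notin> \<Delta> \<Longrightarrow> (\<Prod>i\<in>F. poly_var i) \<in> (SR_ideal n \<Delta> :: 'k mpoly set)"
proof -
  interpret cring "poly_ring n :: 'k mpoly ring" by (rule poly_ring_cring)
  have sub: "{(\<Prod>i\<in>F. poly_var i) | F. F \<subseteq> {1..n} \<and> F \<notin> \<Delta>} \<subseteq> carrier (poly_ring n :: 'k mpoly ring)"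
  proof safe
    fix F assume F: "F \<subseteq> {1..n}"
    then have "finite F" using finite_subset by blast
    then show "(\<Prod>i\<in>F. poly_var i) \<in> carrier (poly_ring n :: 'k mpoly ring)"
      using F by (simp add: prod_poly_var poly_ring_carrier_iff keys_sum_single[simplified])
  qed
  show "ideal (SR_ideal n \<Delta> :: 'k mpoly set) (poly_ring n)"
    unfolding SR_ideal_def by (rule genideal_ideal[OF sub])
  show "(\<Prod>i\<in>F. poly_var i) \<in> (SR_ideal n \<Delta> :: 'k mpoly set)" if "F \<subseteq> {1..n}" "F \<notin> \<Delta>"
    using genideal_self[OF sub] that unfolding SR_ideal_def by blast
qed

lemma SR_ideal_closed:
  fixes f g :: "('k::field) mpoly"
  shows "(0 :: 'k mpoly) \<in> SR_ideal n \<Delta>"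
    "f \<in> SR_ideal n \<Delta> \<Longrightarrow> g \<in> SR_ideal n \<Delta> \<Longrightarrow> f + g \<in> SR_ideal n \<Delta>"
    "f \<in> SR_ideal n \<Delta> \<Longrightarrow> - f \<in> SR_ideal n \<Delta>"
    "f \<in> SR_ideal n \<Delta> \<Longrightarrow> g \<in> SR_ideal n \<Delta> \<Longrightarrow> f - g \<in> SR_ideal n \<Delta>"
    "f \<in> SR_ideal n \<Delta> \<Longrightarrow> g \<in> carrier (poly_ring n) \<Longrightarrow> g * f \<in> SR_ideal n \<Delta>"
    "SR_ideal n \<Delta> \<subseteq> carrier (poly_ring n :: 'k mpoly ring)"
proof -
  interpret ideal "SR_ideal n \<Delta> :: 'k mpoly set" "poly_ring n" by (rule SR_ideal_ideal)
  show sub: "SR_ideal n \<Delta> \<subseteq> carrier (poly_ring n :: 'k mpoly ring)" using a_subset by simp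
  show "(0 :: 'k mpoly) \<in> SR_ideal n \<Delta>" using additive_subgroup.zero_closed[OF is_additive_subgroup] by simp
  show add: "f + g \<in> SR_ideal n \<Delta>" if "f \<in> SR_ideal n \<Delta>" "g \<in> SR_ideal n \<Delta>" for f g :: "'k mpoly"
    using additive_subgroup.a_closed[OF is_additive_subgroup that] by simp
  show neg: "- f \<in> SR_ideal n \<Delta>" if "f \<in> SR_ideal n \<Delta>" for f :: "'k mpoly"
    using I_l_closed[OF that poly_ring_closed(5)[OF poly_ring_closed(2)]] by simp
  show "f - g \<in> SR_ideal n \<Delta>" if "f \<in> SR_ideal n \<Delta>" "g \<in> SR_ideal n \<Delta>"
    using add[OF that(1) neg[OF that(2)]] by simp
  show "g * f \<in> SR_ideal n \<Delta>" if "f \<in> SR_ideal n \<Delta>" "g \<in> carrier (poly_ring n)"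
    using I_l_closed[OF that] by simp
qed

lemma poly_mapping_sum_single:
  "f = (\<Sum>m\<in>Poly_Mapping.keys f. Poly_Mapping.single m (Poly_Mapping.lookup f m))"
proof (rule poly_mapping_eqI)
  fix k
  show "Poly_Mapping.lookup f k = Poly_Mapping.lookup (\<Sum>m\<in>Poly_Mapping.keys f. Poly_Mapping.single m (Poly_Mapping.lookup f m)) k"
    by (auto simp: lookup_sum lookup_single when_def in_keys_iff)
qed

text \<open>Supersets of nonfaces are nonfaces, so the right-hand side defines an ideal
  \<open>J\<close>, and it contains the generators. Conversely, a monomial whose support is a
  nonface is a multiple of the squarefree monomial on that support.\<close>

lemma SR_ideal_iff:
  fixes f :: "('k::field) mpoly"
  assumes down: "\<forall>F\<in>\<Delta>. Pow F \<subseteq> \<Delta>"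
  shows "f \<in> SR_ideal n \<Delta> \<longleftrightarrow>
    f \<in> carrier (poly_ring n) \<and> (\<forall>m\<in>Poly_Mapping.keys f. Poly_Mapping.keys m \<notin> \<Delta>)"
proof -
  interpret cring "poly_ring n :: 'k mpoly ring" by (rule poly_ring_cring)
  define J :: "'k mpoly set" where
    "J = {f \<in> carrier (poly_ring n). \<forall>m\<in>Poly_Mapping.keys f. Poly_Mapping.keys m \<notin> \<Delta>}"
  have mult: "g * f \<in> J" if "f \<in> J" "g \<in> carrier (poly_ring n)" for f g
  proof -
    have "Poly_Mapping.keys m \<notin> \<Delta>" if "m \<in> Poly_Mapping.keys (g * f)" for m
      using that
    proof (rule poly_mult_keysE)
      fix a b assume "b \<in> Poly_Mapping.keys f" "Poly_Mapping.keys m = Poly_Mapping.keys a \<union> Poly_Mapping.keys b"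
      moreover have "Pow (Poly_Mapping.keys m) \<subseteq> \<Delta>" if "Poly_Mapping.keys m \<in> \<Delta>"
        using that down by blast
      ultimately show ?thesis using \<open>f \<in> J\<close> by (auto simp: J_def)
    qed
    then show ?thesis using that poly_ring_closed(4)[of g n f] by (simp add: J_def)
  qed
  have "ideal J (poly_ring n)"
  proof (rule idealI)
    show "ring (poly_ring n :: 'k mpoly ring)" by (rule ring_axioms)
    show "subgroup J (add_monoid (poly_ring n))"
    proof (rule add.subgroupI)
      show "J \<noteq> {}" using poly_ring_closed(1)[of n] by (auto simp: J_def)
      show "\<ominus>\<^bsub>poly_ring n\<^esub> f \<in> J" if "f \<in> J" for f
        using that poly_ring_closed(5)[of f n] by (auto simp: J_def poly_ring_uminus in_keys_iff)
      show "f \<oplus>\<^bsub>poly_ring n\<^esub> g \<in> J" if "f \<in> J" "g \<in> J" for f g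
        using that keys_add[of f g] poly_ring_closed(3)[of f n g] by (auto simp: J_def)
    qed (auto simp: J_def)
    show "g \<otimes>\<^bsub>poly_ring n\<^esub> f \<in> J" "f \<otimes>\<^bsub>poly_ring n\<^esub> g \<in> J"
      if "f \<in> J" "g \<in> carrier (poly_ring n)" for f g
      using mult[OF that] by (simp_all add: mult.commute)
  qed
  moreover have "{(\<Prod>i\<in>F. poly_var i) | F. F \<subseteq> {1..n} \<and> F \<notin> \<Delta>} \<subseteq> J"
  proof safe
    fix F assume F: "F \<subseteq> {1..n}" "F \<notin> \<Delta>"
    then have "finite F" using finite_subset by blast
    then show "(\<Prod>i\<in>F. poly_var i) \<in> J"
      using F by (simp add: J_def prod_poly_var poly_ring_carrier_iff keys_sum_single[simplified])
  qed
  ultimately have "SR_ideal n \<Delta> \<subseteq> J" unfolding SR_ideal_def by (rule genideal_minimal)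
  moreover have "f \<in> SR_ideal n \<Delta>" if f: "f \<in> J" for f
  proof -
    have "(\<Sum>m\<in>S. Poly_Mapping.single m (Poly_Mapping.lookup f m)) \<in> SR_ideal n \<Delta>"
      if "finite S" "S \<subseteq> Poly_Mapping.keys f" for S
      using that
    proof (induction S)
      case empty
      then show ?case by (simp add: SR_ideal_closed(1))
    next
      case (insert m S)
      let ?K = "Poly_Mapping.keys m"
      let ?s = "\<Sum>i\<in>?K. Poly_Mapping.single i (1::nat)"
      have K: "?K \<subseteq> {1..n}" "?K \<notin> \<Delta>" using f insert.prems by (auto simp: J_def poly_ring_carrier_iff)
      \<comment> \<open>Truncated subtraction is exact here, all exponents of \<open>m\<close> on
        its support being at least 1.\<close>
      have "m = (m - ?s) + ?s"
        by (intro poly_mapping_eqI)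
          (auto simp: lookup_add lookup_minus lookup_sum lookup_single when_def in_keys_iff)
      then have "Poly_Mapping.single m (Poly_Mapping.lookup f m)
          = Poly_Mapping.single (m - ?s) (Poly_Mapping.lookup f m) * (\<Prod>i\<in>?K. poly_var i)"
        by (simp add: prod_poly_var mult_single)
      moreover have "Poly_Mapping.single (m - ?s) (Poly_Mapping.lookup f m) \<in> carrier (poly_ring n)"
        using K by (auto simp: poly_ring_carrier_iff in_keys_iff lookup_minus subset_iff)
      ultimately have "Poly_Mapping.single m (Poly_Mapping.lookup f m) \<in> SR_ideal n \<Delta>"
        using SR_ideal_closed(5)[OF SR_ideal_generator[OF K]] by simp
      then show ?case using insert SR_ideal_closed(2) by simp
    qed
    from this[OF finite_keys subset_refl] show ?thesis
      by (simp only: poly_mapping_sum_single[symmetric])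
  qed
  ultimately have "SR_ideal n \<Delta> = J" by blast
  then show ?thesis by (simp add: J_def)
qed

lemma SR_class_eq_iff:
  fixes f g :: "('k::field) mpoly"
  shows "SR_class n \<Delta> f = SR_class n \<Delta> g \<longleftrightarrow> f - g \<in> SR_ideal n \<Delta>"
proof -
  have cls: "SR_class n \<Delta> h = {i + h | i. i \<in> SR_ideal n \<Delta>}" for h :: "'k mpoly"
    unfolding SR_class_def a_r_coset_def' by auto
  show ?thesis
  proof
    assume "SR_class n \<Delta> f = SR_class n \<Delta> g"
    moreover have "0 + f \<in> SR_class n \<Delta> f" unfolding cls using SR_ideal_closed(1) by blast
    ultimately show "f - g \<in> SR_ideal n \<Delta>" unfolding cls by auto
  next
    assume *: "f - g \<in> SR_ideal n \<Delta>"
    have "i + f = (i + (f - g)) + g" "i + g = (i - (f - g)) + f" for i by simp_all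
    then show "SR_class n \<Delta> f = SR_class n \<Delta> g"
      unfolding cls using SR_ideal_closed(2,4)[OF _ *] by blast
  qed
qed

lemma SR_class_hom: "SR_class n \<Delta> \<in> ring_hom (poly_ring n) (SR_ring n \<Delta> :: ('k::field) mpoly set ring)"
proof -
  have "SR_class n \<Delta> = (+>\<^bsub>poly_ring n\<^esub>) (SR_ideal n \<Delta> :: 'k mpoly set)" by (auto simp: SR_class_def)
  then show ?thesis using ideal.rcos_ring_hom[OF SR_ideal_ideal] by (simp add: SR_ring_def)
qed

lemma SR_ring_cring: "cring (SR_ring n \<Delta> :: ('k::field) mpoly set ring)"
  unfolding SR_ring_def by (rule ideal.quotient_is_cring[OF SR_ideal_ideal poly_ring_cring])

lemma SR_ring_carrier: "carrier (SR_ring n \<Delta> :: ('k::field) mpoly set ring) = SR_class n \<Delta> ` carrier (poly_ring n)"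
  by (auto simp: SR_ring_def FactRing_def A_RCOSETS_def' SR_class_def)

lemma SR_class_ops:
  fixes f g :: "('k::field) mpoly"
  assumes "f \<in> carrier (poly_ring n)" "g \<in> carrier (poly_ring n)"
  shows "SR_class n \<Delta> f \<oplus>\<^bsub>SR_ring n \<Delta>\<^esub> SR_class n \<Delta> g = SR_class n \<Delta> (f + g)"
    "SR_class n \<Delta> f \<otimes>\<^bsub>SR_ring n \<Delta>\<^esub> SR_class n \<Delta> g = SR_class n \<Delta> (f * g)"
  using ring_hom_add[OF SR_class_hom assms] ring_hom_mult[OF SR_class_hom assms] by simp_all

lemma SR_ring_zero: "\<zero>\<^bsub>SR_ring n \<Delta>\<^esub> = SR_class n \<Delta> (0 :: ('k::field) mpoly)"
proof -
  interpret ring_hom_ring "poly_ring n :: 'k mpoly ring" "SR_ring n \<Delta>" "SR_class n \<Delta>"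
    by (intro ring_hom_ringI2 cring.axioms(1) poly_ring_cring SR_ring_cring SR_class_hom)
  show ?thesis using hom_zero by simp
qed

lemma SR_module_simps:
  fixes f :: "('k::field) mpoly"
  shows "carrier (SR_module n \<Delta> :: ('k mpoly, _) module) = carrier (SR_ring n \<Delta>)"
    "\<zero>\<^bsub>SR_module n \<Delta> :: ('k mpoly, _) module\<^esub> = \<zero>\<^bsub>SR_ring n \<Delta>\<^esub>"
    "X \<oplus>\<^bsub>SR_module n \<Delta>\<^esub> Y = X \<oplus>\<^bsub>SR_ring n \<Delta>\<^esub> Y"
    "f \<odot>\<^bsub>SR_module n \<Delta>\<^esub> X = SR_class n \<Delta> f \<otimes>\<^bsub>SR_ring n \<Delta>\<^esub> X"
  by (simp_all add: SR_module_def quotient_module_def SR_ring_def SR_class_def)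

lemma SR_module_module: "module (poly_ring n) (SR_module n \<Delta> :: (('k::field) mpoly, _) module)"
proof -
  interpret Q: cring "SR_ring n \<Delta> :: 'k mpoly set ring" by (rule SR_ring_cring)
  have cl: "SR_class n \<Delta> f \<in> carrier (SR_ring n \<Delta>)" if "f \<in> carrier (poly_ring n)" for f :: "'k mpoly"
    using that by (simp add: SR_ring_carrier)
  have one: "SR_class n \<Delta> (1 :: 'k mpoly) = \<one>\<^bsub>SR_ring n \<Delta>\<^esub>"
    using ring_hom_one[OF SR_class_hom, of n \<Delta>] by simp
  show ?thesis
  proof (rule moduleI)
    show "abelian_group (SR_module n \<Delta> :: ('k mpoly, _) module)"
    proof (rule abelian_groupI)
      show "\<exists>Y\<in>carrier (SR_module n \<Delta> :: ('k mpoly, _) module).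
          Y \<oplus>\<^bsub>SR_module n \<Delta>\<^esub> X = \<zero>\<^bsub>SR_module n \<Delta> :: ('k mpoly, _) module\<^esub>"
        if "X \<in> carrier (SR_module n \<Delta> :: ('k mpoly, _) module)" for X
        using that by (intro bexI[of _ "\<ominus>\<^bsub>SR_ring n \<Delta>\<^esub> X"]) (auto simp: SR_module_simps Q.l_neg)
    qed (auto simp: SR_module_simps Q.a_ac)
  qed (auto simp: SR_module_simps poly_ring_cring cl Q.l_distr Q.r_distr Q.m_assoc one
      SR_class_ops[symmetric])
qed

text \<open>If \<open>A \<union> B\<close> has no face meeting both \<open>A\<close> and \<open>B\<close>, the cochain \<open>x\<^sub>a\<close> for \<open>a \<in> A\<close>, \<open>0\<close> for
  \<open>b \<in> B\<close> is a cocycle; were it a coboundary of \<open>f\<close>, the constant term of \<open>f\<close> would be both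
  \<open>1\<close> and \<open>0\<close>.\<close>

lemma SR_module_not_koszul_exact:
  assumes down: "\<forall>F\<in>\<Delta>. Pow F \<subseteq> \<Delta>"
    and ys: "distinct ys" "set ys = A \<union> B" "A \<inter> B = {}" "A \<noteq> {}" "B \<noteq> {}"
    and vert: "\<And>i. i \<in> A \<union> B \<Longrightarrow> i \<in> {1..n} \<and> {i} \<in> \<Delta>"
    and sep: "\<And>a b. a \<in> A \<Longrightarrow> b \<in> B \<Longrightarrow> {a, b} \<notin> \<Delta>"
  shows "\<not> koszul_exact (SR_module n \<Delta> :: (('k::field) mpoly, _) module) poly_var ys
    (carrier (SR_module n \<Delta> :: ('k mpoly, _) module)) 1"
proof
  let ?M = "SR_module n \<Delta> :: ('k mpoly, _) module"
  interpret M: module "poly_ring n :: 'k mpoly ring" ?M by (rule SR_module_module)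
  assume exact: "koszul_exact ?M poly_var ys (carrier ?M) 1"
  have x: "poly_var ` set ys \<subseteq> carrier (poly_ring n :: 'k mpoly ring)"
    using vert ys(2) poly_var_image_closed[of "set ys" n] by blast
  define g :: "nat set \<Rightarrow> 'k mpoly" where "g T = (if \<exists>a\<in>A. T = {a} then poly_var (the_elem T) else 0)" for T
  have gA: "g {a} = poly_var a" if "a \<in> A" for a using that by (simp add: g_def)
  have gB: "g {b} = 0" if "b \<in> B" for b using that ys(3) by (auto simp: g_def)
  have var: "poly_var i \<in> carrier (poly_ring n :: 'k mpoly ring)" if "i \<in> set ys" for i
    using x that by blast
  have gR: "g T \<in> carrier (poly_ring n)" for T
    using var ys(2) poly_ring_closed(1) by (auto simp: g_def)
  have smult: "poly_var i \<odot>\<^bsub>?M\<^esub> SR_class n \<Delta> f = SR_class n \<Delta> (poly_var i * f)"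
    if "i \<in> set ys" "f \<in> carrier (poly_ring n)" for i f
    using SR_class_ops(2)[OF var[OF that(1)] that(2)] by (simp add: SR_module_simps)
  have edge: "poly_var a * poly_var b \<in> (SR_ideal n \<Delta> :: 'k mpoly set)" if "a \<in> A" "b \<in> B" for a b
  proof -
    have "a \<noteq> b" "{a, b} \<subseteq> {1..n}" using that ys(3) vert by auto
    then show ?thesis using SR_ideal_generator[of "{a, b}" n \<Delta>] sep[OF that] by simp
  qed
  define c where "c T = SR_class n \<Delta> (g T)" for T
  have c: "range c \<subseteq> carrier ?M" using gR by (auto simp: c_def SR_module_simps SR_ring_carrier)
  have pair: "poly_var s \<odot>\<^bsub>?M\<^esub> c {t} = poly_var t \<odot>\<^bsub>?M\<^esub> c {s}"
    if "s \<in> set ys" "t \<in> set ys" for s t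
  proof -
    \<comment> \<open>Inside one part the difference is 0; across the parts it is, up to sign, a
      product of variables from \<open>A\<close> and \<open>B\<close>, which lies in the
      ideal.\<close>
    have "poly_var s * g {t} - poly_var t * g {s} \<in> SR_ideal n \<Delta>"
      using that ys(2) edge[of s t] edge[of t s] SR_ideal_closed(1) SR_ideal_closed(3)[of "poly_var s * poly_var t" n \<Delta>]
      by (auto simp: gA gB mult.commute)
    then show ?thesis
      unfolding c_def smult[OF that(1) gR] smult[OF that(2) gR] by (simp add: SR_class_eq_iff)
  qed
  have "koszul_d ?M poly_var ys c T = \<zero>\<^bsub>?M\<^esub>" if "T \<subseteq> set ys" "card T = Suc 1" for T
    using M.koszul_d_cocycle_pairs[OF x c ys(1) pair that(1)] that(2) by simp
  then obtain b where b: "range b \<subseteq> carrier ?M"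
    and cb: "\<And>T. T \<subseteq> set ys \<Longrightarrow> card T = 1 \<Longrightarrow> c T = koszul_d ?M poly_var ys b T"
    using exact[unfolded koszul_exact_def, THEN spec, THEN mp, of c] c by auto
  obtain f where f: "f \<in> carrier (poly_ring n)" "b {} = SR_class n \<Delta> f"
    using b by (auto simp: SR_module_simps SR_ring_carrier)
  have "Poly_Mapping.lookup (g {t}) (Poly_Mapping.single t 1) = Poly_Mapping.lookup f 0" if t: "t \<in> set ys" for t
  proof -
    have "SR_class n \<Delta> (g {t}) = SR_class n \<Delta> (poly_var t * f)"
      using cb[of "{t}"] t M.koszul_d_singleton[OF x b t] f smult[OF t f(1)] by (simp add: c_def)
    then have "g {t} - poly_var t * f \<in> SR_ideal n \<Delta>" by (simp add: SR_class_eq_iff)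
    \<comment> \<open>Since \<open>{t}\<close> is a face, elements of the ideal have no linear term
      in \<open>t\<close>. So the coefficient of \<open>g {t}\<close> there is the constant term of
      \<open>f\<close>, the same for all \<open>t\<close>.\<close>
    then have "Poly_Mapping.single t 1 \<notin> Poly_Mapping.keys (g {t} - poly_var t * f)"
      using SR_ideal_iff[OF down] vert[of t] t ys(2) by fastforce
    then show ?thesis by (simp add: in_keys_iff lookup_minus lookup_poly_var_mult)
  qed
  then have "Poly_Mapping.lookup f 0 = 1" "Poly_Mapping.lookup f 0 = 0"
    using ys(2,4,5) gA gB by (force simp: poly_var_def)+
  then show False by simp
qed

lemma SR_module_projective_dimension_bound:
  assumes pd: "projective_dimension (poly_ring n) (SR_module n \<Delta> :: (('k::field) mpoly, _) module) = enat p"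
    and down: "\<forall>F\<in>\<Delta>. Pow F \<subseteq> \<Delta>"
    and AB: "A \<inter> B = {}" "A \<noteq> {}" "B \<noteq> {}"
    and vert: "\<And>i. i \<in> A \<union> B \<Longrightarrow> i \<in> {1..n} \<and> {i} \<in> \<Delta>"
    and sep: "\<And>a b. a \<in> A \<Longrightarrow> b \<in> B \<Longrightarrow> {a, b} \<notin> \<Delta>"
  shows "card (A \<union> B) \<le> p + 1"
proof (rule ccontr)
  assume neg: "\<not> ?thesis"
  have sub: "A \<union> B \<subseteq> {1..n}" using vert by blast
  then have "finite (A \<union> B)" using finite_subset by blast
  then obtain ys where ys: "set ys = A \<union> B" "distinct ys" using finite_distinct_list by blast
  then have len: "length ys = card (A \<union> B)" using distinct_card by fastforce
  obtain P :: "nat \<Rightarrow> ('k mpoly, nat \<times> 'k mpoly \<times> 'k mpoly set \<Rightarrow> 'k mpoly) module" and \<delta> \<epsilon>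
    where res: "projective_resolution (poly_ring n) (SR_module n \<Delta> :: ('k mpoly, _) module) P \<delta> \<epsilon>"
      and l: "\<And>i. i > p \<Longrightarrow> carrier (P i) = {\<zero>\<^bsub>P i\<^esub>}"
    using projective_dimension_enatE[OF pd] by blast
  have "projective_module (poly_ring n) (P q)" for q
    using res by (simp add: projective_resolution_def)
  then have "koszul_exact (P q) poly_var ys (carrier (P q)) i" if "i < length ys" for q i
    using projective_module_koszul_exact[of n "P q" ys i] that ys sub by simp
  \<comment> \<open>By \<open>neg\<close> the list has at least \<open>p + 2\<close> entries, which
    is the requirement \<open>1 + p < length ys\<close> for degree one.\<close>
  then have "koszul_exact (SR_module n \<Delta> :: ('k mpoly, _) module) poly_var ys
      (carrier (SR_module n \<Delta> :: ('k mpoly, _) module)) 1"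
    using projective_resolution_koszul_exact[OF res SR_module_module l poly_var_image_closed] neg len ys sub
    by simp
  moreover have "\<not> koszul_exact (SR_module n \<Delta> :: ('k mpoly, _) module) poly_var ys
      (carrier (SR_module n \<Delta> :: ('k mpoly, _) module)) 1"
    by (rule SR_module_not_koszul_exact[OF down ys(2,1) AB]) (use vert sep in blast)+
  ultimately show False by blast
qed

section \<open>Hilbert series\<close>

lemma one_minus_fps_X_power_nth:
  "fps_nth ((1 - fps_X :: int fps) ^ m) i = (-1) ^ i * int (m choose i)"
proof (induction m arbitrary: i)
  case 0
  then show ?case by (cases i) auto
next
  case (Suc m)
  have "(1 - fps_X :: int fps) ^ Suc m = (1 - fps_X) ^ m - fps_X * (1 - fps_X) ^ m"
    by (simp add: algebra_simps)
  then have "fps_nth ((1 - fps_X :: int fps) ^ Suc m) i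
      = fps_nth ((1 - fps_X) ^ m) i - fps_nth (fps_X * (1 - fps_X) ^ m) i"
    by (simp only: fps_sub_nth)
  then show ?case by (cases i) (auto simp: Suc.IH algebra_simps)
qed

section \<open>Counting monomials by their support\<close>

lemma monomial_degree_superset:
  assumes "finite S" "Poly_Mapping.keys m \<subseteq> S"
  shows "monomial_degree m = (\<Sum>i\<in>S. Poly_Mapping.lookup m i)"
  unfolding monomial_degree_def
  by (rule sum.mono_neutral_left) (use assms in \<open>auto simp: in_keys_iff\<close>)

lemma monomial_degree_single_add:
  "monomial_degree (Poly_Mapping.single a 1 + m) = Suc (monomial_degree m)"
proof -
  let ?S = "insert a (Poly_Mapping.keys m)"
  have "monomial_degree (Poly_Mapping.single a 1 + m)
      = (\<Sum>i\<in>?S. Poly_Mapping.lookup (Poly_Mapping.single a 1 + m) i)"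
    by (rule monomial_degree_superset) (auto simp: keys_plus_nat)
  also have "\<dots> = (\<Sum>i\<in>?S. Poly_Mapping.lookup (Poly_Mapping.single a 1) i) + (\<Sum>i\<in>?S. Poly_Mapping.lookup m i)"
    by (simp add: lookup_add sum.distrib)
  also have "(\<Sum>i\<in>?S. Poly_Mapping.lookup (Poly_Mapping.single a (1::nat)) i) = 1"
    by (simp add: lookup_single when_def)
  also have "(\<Sum>i\<in>?S. Poly_Mapping.lookup m i) = monomial_degree m"
    by (rule monomial_degree_superset[symmetric]) auto
  finally show ?thesis by simp
qed

text \<open>The support is exactly \<open>F\<close>, not merely inside \<open>F\<close>, so that the
  monomials surviving in the quotient are a disjoint union over the faces.\<close>

definition monomials :: "nat set \<Rightarrow> nat \<Rightarrow> (nat \<Rightarrow>\<^sub>0 nat) set" where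
  "monomials F s = {m. Poly_Mapping.keys m = F \<and> monomial_degree m = s}"

lemma monomials_empty: "monomials {} s = (if s = 0 then {0} else {})"
  by (auto simp: monomials_def monomial_degree_def)

lemma monomials_insert_0: "monomials (insert a F) 0 = {}"
  by (fastforce simp: monomials_def monomial_degree_def in_keys_iff)

text \<open>Removing one factor \<open>a\<close> either uses up its exponent, leaving support
  \<open>F\<close>, or leaves the support as it was.\<close>

lemma monomials_insert_Suc:
  assumes "a \<notin> F"
  shows "monomials (insert a F) (Suc s)
    = (\<lambda>m. Poly_Mapping.single a 1 + m) ` (monomials F s \<union> monomials (insert a F) s)"
proof
  show "(\<lambda>m. Poly_Mapping.single a 1 + m) ` (monomials F s \<union> monomials (insert a F) s)
      \<subseteq> monomials (insert a F) (Suc s)"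
    unfolding monomials_def
    by (intro image_subsetI CollectI) (auto simp: keys_plus_nat monomial_degree_single_add[simplified])
  show "monomials (insert a F) (Suc s)
      \<subseteq> (\<lambda>m. Poly_Mapping.single a 1 + m) ` (monomials F s \<union> monomials (insert a F) s)"
  proof
    fix m assume m: "m \<in> monomials (insert a F) (Suc s)"
    let ?m = "m - Poly_Mapping.single a 1"
    have a: "a \<in> Poly_Mapping.keys m" using m by (simp add: monomials_def)
    note eq = poly_mapping_minus_single_add[OF a]
    have "monomial_degree ?m = s"
      using m monomial_degree_single_add[of a ?m] unfolding eq by (simp add: monomials_def)
    moreover have "insert a (Poly_Mapping.keys ?m) = insert a F"
      using m keys_plus_nat[of "Poly_Mapping.single a 1" ?m] unfolding eq by (simp add: monomials_def)
    then have "Poly_Mapping.keys ?m = F \<or> Poly_Mapping.keys ?m = insert a F"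
      using assms by (cases "a \<in> Poly_Mapping.keys ?m") auto
    ultimately have "?m \<in> monomials F s \<union> monomials (insert a F) s"
      by (auto simp: monomials_def)
    then show "m \<in> (\<lambda>m. Poly_Mapping.single a 1 + m) ` (monomials F s \<union> monomials (insert a F) s)"
      using eq by (metis image_eqI)
  qed
qed

lemma finite_monomials: "finite F \<Longrightarrow> finite (monomials F s)"
proof (induction F arbitrary: s rule: finite_induct)
  case empty
  then show ?case by (simp add: monomials_empty)
next
  case (insert a F)
  show ?case
    by (induction s) (use insert in \<open>auto simp: monomials_insert_0 monomials_insert_Suc\<close>)
qed

lemma card_monomials_insert_Suc:
  assumes "finite F" "a \<notin> F"
  shows "card (monomials (insert a F) (Suc s)) = card (monomials F s) + card (monomials (insert a F) s)"
proof -
  have "monomials F s \<inter> monomials (insert a F) s = {}" using assms by (auto simp: monomials_def)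
  moreover have "inj (\<lambda>m. Poly_Mapping.single a (1::nat) + m)" by (auto intro: injI)
  then have "inj_on (\<lambda>m. Poly_Mapping.single a (1::nat) + m) (monomials F s \<union> monomials (insert a F) s)"
    using inj_on_subset by blast
  ultimately show ?thesis
    unfolding monomials_insert_Suc[OF assms(2)]
    using assms by (simp add: card_image card_Un_disjoint finite_monomials)
qed

text \<open>The generating function is (z / (1 - z))^|F|, cleared of denominators; the recursion for
  the counts yields one factor z / (1 - z) for each element.\<close>

lemma monomials_series:
  assumes "finite F"
  shows "Abs_fps (\<lambda>s. int (card (monomials F s))) * (1 - fps_X) ^ card F = fps_X ^ card F"
  using assms
proof (induction F rule: finite_induct)
  case empty
  have "Abs_fps (\<lambda>s. int (card (monomials {} s))) = 1"
    by (rule fps_ext) (simp add: monomials_empty)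
  then show ?case by simp
next
  case (insert a F)
  let ?G = "\<lambda>F. Abs_fps (\<lambda>s. int (card (monomials F s)))"
  have step: "?G (insert a F) * (1 - fps_X) = fps_X * ?G F"
  proof (rule fps_ext)
    fix s
    have "?G (insert a F) * (1 - fps_X) = ?G (insert a F) - fps_X * ?G (insert a F)"
      by (simp add: algebra_simps)
    then have "fps_nth (?G (insert a F) * (1 - fps_X)) s
        = fps_nth (?G (insert a F)) s - fps_nth (fps_X * ?G (insert a F)) s"
      by (simp only: fps_sub_nth)
    then show "fps_nth (?G (insert a F) * (1 - fps_X)) s = fps_nth (fps_X * ?G F) s"
      using insert.hyps by (cases s) (simp_all add: monomials_insert_0 card_monomials_insert_Suc)
  qed
  have "?G (insert a F) * (1 - fps_X) ^ card (insert a F) = (?G (insert a F) * (1 - fps_X)) * (1 - fps_X) ^ card F"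
    using insert.hyps by (simp add: algebra_simps)
  also have "\<dots> = fps_X * (?G F * (1 - fps_X) ^ card F)" unfolding step by (simp add: algebra_simps)
  finally show ?case using insert by simp
qed

section \<open>Monomial bases of the graded pieces\<close>

lemma subfield_poly_const: "subfield (range poly_const) (poly_ring n :: ('k::field) mpoly ring)"
proof -
  interpret cring "poly_ring n :: 'k mpoly ring" by (rule poly_ring_cring)
  let ?K = "range poly_const :: 'k mpoly set"
  have cl: "poly_const c \<in> carrier (poly_ring n)" for c :: 'k
    by (auto simp: poly_const_def poly_ring_carrier_iff)
  have ops: "poly_const c + poly_const d = poly_const (c + d)" "poly_const c * poly_const d = poly_const (c * d)"
    "- poly_const c = poly_const (- c)" "1 = poly_const (1 :: 'k)" "poly_const c = 0 \<longleftrightarrow> c = 0" for c d :: 'k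
    by (simp_all add: poly_const_def single_add mult_single single_uminus)
      (metis lookup_single_eq lookup_zero single_zero)
  have "subring ?K (poly_ring n)"
  proof (rule subringI)
    show "\<one>\<^bsub>poly_ring n\<^esub> \<in> ?K" using ops(4) by simp
  qed (use cl in \<open>auto simp: ops poly_ring_uminus\<close>)
  then have "subcring ?K (poly_ring n)" by (rule subcringI) (auto simp: mult.commute)
  moreover have "Units (poly_ring n\<lparr>carrier := ?K\<rparr>) = ?K - {\<zero>\<^bsub>poly_ring n\<^esub>}"
  proof
    show "Units (poly_ring n\<lparr>carrier := ?K\<rparr>) \<subseteq> ?K - {\<zero>\<^bsub>poly_ring n\<^esub>}"
      by (auto simp: Units_def)
    show "?K - {\<zero>\<^bsub>poly_ring n\<^esub>} \<subseteq> Units (poly_ring n\<lparr>carrier := ?K\<rparr>)"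
    proof
      fix f assume "f \<in> ?K - {\<zero>\<^bsub>poly_ring n\<^esub>}"
      then obtain c where "f = poly_const c" "c \<noteq> 0" by (auto simp: ops)
      then have "f * poly_const (inverse c) = 1" by (simp add: ops(2,4))
      then show "f \<in> Units (poly_ring n\<lparr>carrier := ?K\<rparr>)"
        using \<open>f = poly_const c\<close> by (auto simp: Units_def mult.commute)
    qed
  qed
  ultimately show ?thesis by (rule subfieldI)
qed

lemma SR_subfield_const:
  assumes down: "\<forall>F\<in>\<Delta>. Pow F \<subseteq> \<Delta>" and "{} \<in> \<Delta>"
  shows "subfield (SR_class n \<Delta> ` range poly_const) (SR_ring n \<Delta> :: ('k::field) mpoly set ring)"
proof -
  interpret ring_hom_ring "poly_ring n :: 'k mpoly ring" "SR_ring n \<Delta>" "SR_class n \<Delta>"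
    by (intro ring_hom_ringI2 cring.axioms(1) poly_ring_cring SR_ring_cring SR_class_hom)
  \<comment> \<open>The empty face keeps 1 out of the ideal, so the quotient is not the zero ring
    and the coefficient field embeds.\<close>
  have "(1 :: 'k mpoly) \<notin> SR_ideal n \<Delta>"
    using SR_ideal_iff[OF down, where f = "1 :: 'k mpoly"] assms(2) by auto
  then have "\<one>\<^bsub>SR_ring n \<Delta>\<^esub> \<noteq> \<zero>\<^bsub>SR_ring n \<Delta> :: 'k mpoly set ring\<^esub>"
    using hom_one by (simp add: SR_ring_zero SR_class_eq_iff flip: hom_one)
  then show ?thesis by (rule img_is_subfield(2)[OF subfield_poly_const])
qed

text \<open>The dimension is built up by one line extension per monomial. The new class is outside
  the old span, since otherwise the ideal would contain a polynomial with coefficient 1 at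
  \<open>m\<close>, whose support is a face.\<close>

lemma SR_dimension_monomials:
  assumes down: "\<forall>F\<in>\<Delta>. Pow F \<subseteq> \<Delta>"
    and "finite Ms" and "\<And>m. m \<in> Ms \<Longrightarrow> Poly_Mapping.keys m \<in> \<Delta> \<and> Poly_Mapping.keys m \<subseteq> {1..n}"
  shows "ring.dimension (SR_ring n \<Delta> :: ('k::field) mpoly set ring) (card Ms)
    (SR_class n \<Delta> ` range poly_const) (SR_class n \<Delta> ` {f. Poly_Mapping.keys f \<subseteq> Ms})"
  using assms(2,3)
proof (induction Ms rule: finite_induct)
  case empty
  interpret Q: cring "SR_ring n \<Delta> :: 'k mpoly set ring" by (rule SR_ring_cring)
  have "{f :: 'k mpoly. Poly_Mapping.keys f \<subseteq> {}} = {0}" by auto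
  then show ?case using Q.zero_dim by (simp add: SR_ring_zero)
next
  case (insert m Ms)
  interpret Q: cring "SR_ring n \<Delta> :: 'k mpoly set ring" by (rule SR_ring_cring)
  let ?K = "SR_class n \<Delta> ` range poly_const :: 'k mpoly set set"
  let ?E = "\<lambda>Ms. SR_class n \<Delta> ` {f :: 'k mpoly. Poly_Mapping.keys f \<subseteq> Ms}"
  let ?v = "SR_class n \<Delta> (Poly_Mapping.single m 1 :: 'k mpoly)"
  have m: "Poly_Mapping.keys m \<in> \<Delta>" "Poly_Mapping.keys m \<subseteq> {1..n}" using insert.prems by auto
  have single: "Poly_Mapping.single m c \<in> carrier (poly_ring n)" for c :: 'k
    using m by (simp add: poly_ring_carrier_iff)
  have span: "f \<in> carrier (poly_ring n)" if "Poly_Mapping.keys f \<subseteq> Ms" for f :: "'k mpoly"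
    using that insert.prems by (auto simp: poly_ring_carrier_iff)
  have const: "poly_const c \<in> carrier (poly_ring n)" for c :: 'k
    by (auto simp: poly_const_def poly_ring_carrier_iff)
  have line: "SR_class n \<Delta> (poly_const c) \<otimes>\<^bsub>SR_ring n \<Delta>\<^esub> ?v \<oplus>\<^bsub>SR_ring n \<Delta>\<^esub> SR_class n \<Delta> f
      = SR_class n \<Delta> (Poly_Mapping.single m c + f)"
    if "Poly_Mapping.keys f \<subseteq> Ms" for c and f :: "'k mpoly"
    using SR_class_ops(2)[OF const[of c] single[of 1]] SR_class_ops(1)[OF single[of c] span[OF that]]
    by (simp add: poly_const_def mult_single)
  have "?v \<in> carrier (SR_ring n \<Delta>)" using single by (simp add: SR_ring_carrier)
  moreover have "?v \<notin> ?E Ms"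
  proof
    assume "?v \<in> ?E Ms"
    then obtain f :: "'k mpoly" where f: "Poly_Mapping.keys f \<subseteq> Ms"
      and "Poly_Mapping.single m 1 - f \<in> SR_ideal n \<Delta>" by (auto simp: SR_class_eq_iff)
    then have "m \<notin> Poly_Mapping.keys (Poly_Mapping.single m 1 - f)"
      using SR_ideal_iff[OF down, where f = "Poly_Mapping.single m 1 - f"] m by auto
    moreover have "m \<notin> Poly_Mapping.keys f" using f insert.hyps by auto
    ultimately show False by (simp add: in_keys_iff lookup_minus)
  qed
  moreover have "Q.dimension (card Ms) ?K (?E Ms)" using insert by simp
  ultimately have "Q.dimension (Suc (card Ms)) ?K (Q.line_extension ?K ?v (?E Ms))"
    by (rule Q.Suc_dim)
  moreover have "Q.line_extension ?K ?v (?E Ms) = ?E (insert m Ms)"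
  proof (intro equalityI subsetI)
    fix X assume "X \<in> Q.line_extension ?K ?v (?E Ms)"
    then obtain c and f :: "'k mpoly" where "Poly_Mapping.keys f \<subseteq> Ms" "X = SR_class n \<Delta> (Poly_Mapping.single m c + f)"
      using line by (auto simp: Q.line_extension_mem_iff)
    moreover from this have "Poly_Mapping.keys (Poly_Mapping.single m c + f) \<subseteq> insert m Ms"
      using keys_add[of "Poly_Mapping.single m c" f] by (auto split: if_splits)
    ultimately show "X \<in> ?E (insert m Ms)" by blast
  next
    fix X assume "X \<in> ?E (insert m Ms)"
    then obtain f :: "'k mpoly" where f: "Poly_Mapping.keys f \<subseteq> insert m Ms" "X = SR_class n \<Delta> f" by blast
    define g where "g = f - Poly_Mapping.single m (Poly_Mapping.lookup f m)"
    have "Poly_Mapping.keys g \<subseteq> Ms"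
    proof
      fix u assume "u \<in> Poly_Mapping.keys g"
      then have "u \<noteq> m" "u \<in> Poly_Mapping.keys f"
        by (auto simp: g_def in_keys_iff lookup_minus lookup_single when_def split: if_splits)
      then show "u \<in> Ms" using f by auto
    qed
    moreover have "f = Poly_Mapping.single m (Poly_Mapping.lookup f m) + g" by (simp add: g_def)
    ultimately show "X \<in> Q.line_extension ?K ?v (?E Ms)"
      using line[of g "Poly_Mapping.lookup f m"] f(2) by (auto simp: Q.line_extension_mem_iff)
  qed
  ultimately show ?case using insert.hyps by simp
qed

lemma hilbert_series_eq:
  assumes down: "\<forall>F\<in>\<Delta>. Pow F \<subseteq> \<Delta>" and "{} \<in> \<Delta>" and \<Delta>: "\<Delta> \<subseteq> Pow {1..n}"
  shows "hilbert_series TYPE('k::field) n \<Delta> = (\<Sum>F\<in>\<Delta>. Abs_fps (\<lambda>s. int (card (monomials F s))))"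
proof (rule fps_ext)
  fix s
  interpret Q: cring "SR_ring n \<Delta> :: 'k mpoly set ring" by (rule SR_ring_cring)
  let ?K = "SR_class n \<Delta> ` range poly_const :: 'k mpoly set set"
  let ?Ms = "\<Union>F\<in>\<Delta>. monomials F s"
  have finF: "finite F" if "F \<in> \<Delta>" for F using that \<Delta> finite_subset[of F "{1..n}"] by blast
  have fin\<Delta>: "finite \<Delta>" using \<Delta> finite_subset by blast
  have fin: "finite ?Ms" using fin\<Delta> finF finite_monomials by blast
  have Ms: "m \<in> ?Ms \<longleftrightarrow> Poly_Mapping.keys m \<in> \<Delta> \<and> monomial_degree m = s" for m
    by (auto simp: monomials_def)
  have "SR_class n \<Delta> ` homogeneous_part n s = SR_class n \<Delta> ` {f :: 'k mpoly. Poly_Mapping.keys f \<subseteq> ?Ms}"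
  proof (intro equalityI subsetI)
    fix X assume "X \<in> SR_class n \<Delta> ` (homogeneous_part n s :: 'k mpoly set)"
    then obtain f :: "'k mpoly" where f: "f \<in> homogeneous_part n s" "X = SR_class n \<Delta> f" by blast
    \<comment> \<open>Dropping the terms of \<open>f\<close> with nonface support does not change
      its class.\<close>
    define g where "g = (\<Sum>m\<in>{m \<in> Poly_Mapping.keys f. Poly_Mapping.keys m \<in> \<Delta>}.
        Poly_Mapping.single m (Poly_Mapping.lookup f m))"
    have g: "Poly_Mapping.lookup g m = (if Poly_Mapping.keys m \<in> \<Delta> then Poly_Mapping.lookup f m else 0)" for m
      by (auto simp: g_def lookup_sum lookup_single when_def in_keys_iff)
    have "f - g \<in> SR_ideal n \<Delta>"
      unfolding SR_ideal_iff[OF down] using f(1)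
      by (auto simp: homogeneous_part_def poly_ring_carrier_iff in_keys_iff lookup_minus g split: if_splits)
    moreover have "Poly_Mapping.keys g \<subseteq> ?Ms"
    proof
      fix m assume "m \<in> Poly_Mapping.keys g"
      then have "Poly_Mapping.keys m \<in> \<Delta>" "m \<in> Poly_Mapping.keys f"
        using g by (auto simp: in_keys_iff split: if_splits)
      then show "m \<in> ?Ms" unfolding Ms using f(1) by (auto simp: homogeneous_part_def)
    qed
    ultimately show "X \<in> SR_class n \<Delta> ` {f :: 'k mpoly. Poly_Mapping.keys f \<subseteq> ?Ms}"
      using f(2) SR_class_eq_iff[of n \<Delta> f g] by blast
  next
    fix X assume "X \<in> SR_class n \<Delta> ` {f :: 'k mpoly. Poly_Mapping.keys f \<subseteq> ?Ms}"
    then obtain f :: "'k mpoly" where f: "Poly_Mapping.keys f \<subseteq> ?Ms" "X = SR_class n \<Delta> f" by blast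
    have "f \<in> homogeneous_part n s"
      using f(1) \<Delta> Ms by (fastforce simp: homogeneous_part_def poly_ring_carrier_iff)
    then show "X \<in> SR_class n \<Delta> ` homogeneous_part n s" using f(2) by blast
  qed
  moreover have "Q.dimension (card ?Ms) ?K (SR_class n \<Delta> ` {f. Poly_Mapping.keys f \<subseteq> ?Ms})"
    by (rule SR_dimension_monomials[OF down fin]) (use Ms \<Delta> in blast)
  ultimately have dim: "Q.dimension (card ?Ms) ?K (SR_class n \<Delta> ` homogeneous_part n s)" by simp
  \<comment> \<open>\<open>dim\<close> is a definite description; that the dimension found is the
    only one depends on the scalars forming a subfield.\<close>
  have "subfield ?K (SR_ring n \<Delta>)" by (rule SR_subfield_const[OF down assms(2)])
  then have "Q.dim ?K (SR_class n \<Delta> ` homogeneous_part n s) = card ?Ms"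
    unfolding Q.dim_def using Q.dimension_is_inj dim by blast
  moreover have "card ?Ms = (\<Sum>F\<in>\<Delta>. card (monomials F s))"
    by (rule card_UN_disjoint) (use fin\<Delta> finF finite_monomials in \<open>auto simp: monomials_def\<close>)
  ultimately show "fps_nth (hilbert_series TYPE('k) n \<Delta>) s
      = fps_nth (\<Sum>F\<in>\<Delta>. Abs_fps (\<lambda>s. int (card (monomials F s)))) s"
    by (simp add: hilbert_series_def fps_sum_nth)
qed

text \<open>Each face contributes z^|F| (1 - z)^(N - |F|). The exponent is left general because
  \<open>N = d\<close> yields the h-vector and \<open>N = n\<close> the sum in question.\<close>

lemma hilbert_series_mult:
  assumes down: "\<forall>F\<in>\<Delta>. Pow F \<subseteq> \<Delta>" and "{} \<in> \<Delta>" and \<Delta>: "\<Delta> \<subseteq> Pow {1..n}"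
    and N: "\<And>F. F \<in> \<Delta> \<Longrightarrow> card F \<le> N"
  shows "fps_nth (hilbert_series TYPE('k::field) n \<Delta> * (1 - fps_X) ^ N) j
    = (\<Sum>F\<in>\<Delta>. if card F \<le> j then (-1) ^ (j - card F) * int ((N - card F) choose (j - card F)) else 0)"
proof -
  have "hilbert_series TYPE('k) n \<Delta> = (\<Sum>F\<in>\<Delta>. Abs_fps (\<lambda>s. int (card (monomials F s))))"
    by (rule hilbert_series_eq[OF assms(1-3)])
  then have "hilbert_series TYPE('k) n \<Delta> * (1 - fps_X) ^ N
      = (\<Sum>F\<in>\<Delta>. Abs_fps (\<lambda>s. int (card (monomials F s))) * (1 - fps_X) ^ N)"
    by (simp add: sum_distrib_right)
  also have "\<dots> = (\<Sum>F\<in>\<Delta>. fps_X ^ card F * (1 - fps_X) ^ (N - card F))"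
  proof (rule sum.cong[OF refl])
    fix F assume F: "F \<in> \<Delta>"
    then have "finite F" using \<Delta> finite_subset[of F "{1..n}"] by blast
    have "(1 - fps_X :: int fps) ^ N = (1 - fps_X) ^ card F * (1 - fps_X) ^ (N - card F)"
      using N[OF F] by (simp flip: power_add)
    then show "Abs_fps (\<lambda>s. int (card (monomials F s))) * (1 - fps_X) ^ N
        = fps_X ^ card F * (1 - fps_X) ^ (N - card F)"
      using monomials_series[OF \<open>finite F\<close>] by (simp add: mult.assoc[symmetric])
  qed
  finally show ?thesis
    by (auto simp: fps_sum_nth fps_X_power_mult_nth one_minus_fps_X_power_nth intro!: sum.cong)
qed

lemma card_supersets:
  assumes "finite V" "F \<subseteq> V"
  shows "card {W. F \<subseteq> W \<and> W \<subseteq> V \<and> card W = j}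
    = (if card F \<le> j then (card V - card F) choose (j - card F) else 0)"
proof -
  have fF: "finite F" using assms finite_subset by blast
  show ?thesis
  proof (cases "card F \<le> j")
    case True
    have "{W. F \<subseteq> W \<and> W \<subseteq> V \<and> card W = j} = (\<lambda>U. F \<union> U) ` {U. U \<subseteq> V - F \<and> card U = j - card F}"
    proof (intro equalityI subsetI)
      fix W assume W: "W \<in> {W. F \<subseteq> W \<and> W \<subseteq> V \<and> card W = j}"
      then have "W - F \<in> {U. U \<subseteq> V - F \<and> card U = j - card F}"
        using fF by (auto simp: card_Diff_subset)
      moreover have "W = F \<union> (W - F)" using W by auto
      ultimately show "W \<in> (\<lambda>U. F \<union> U) ` {U. U \<subseteq> V - F \<and> card U = j - card F}" by blast
    next
      fix W assume "W \<in> (\<lambda>U. F \<union> U) ` {U. U \<subseteq> V - F \<and> card U = j - card F}"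
      then obtain U where U: "U \<subseteq> V - F" "card U = j - card F" "W = F \<union> U" by blast
      then have "finite U" using assms(1) finite_subset by blast
      then have "card W = card F + card U" unfolding U(3) by (rule card_Un_disjoint[OF fF]) (use U in auto)
      then show "W \<in> {W. F \<subseteq> W \<and> W \<subseteq> V \<and> card W = j}" using U True assms by auto
    qed
    moreover have "inj_on (\<lambda>U. F \<union> U) {U. U \<subseteq> V - F \<and> card U = j - card F}" by (auto intro!: inj_onI)
    ultimately show ?thesis
      using True assms fF n_subsets[of "V - F" "j - card F"] by (simp add: card_image card_Diff_subset)
  next
    case False
    then have "{W. F \<subseteq> W \<and> W \<subseteq> V \<and> card W = j} = {}"
      using assms(1) card_mono finite_subset by blast
    then show ?thesis using False by (simp only: card.empty if_False)
  qed
qed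

text \<open>Double counting of pairs of a face \<open>F\<close> inside a \<open>j\<close>-set
  \<open>W\<close>: the binomial coefficient of \<open>F\<close> is the number of
  \<open>j\<close>-sets containing it, and the sign splits into one factor for \<open>j\<close> and
  one for \<open>card F\<close>.\<close>

lemma hilbert_series_clique_complex:
  assumes "\<Delta> = clique_complex {1..n} E"
  shows "fps_nth (hilbert_series TYPE('k::field) n \<Delta> * (1 - fps_X) ^ n) j
    = (-1) ^ j * (\<Sum>W | W \<subseteq> {1..n} \<and> card W = j. clique_euler E W)"
proof -
  have \<Delta>: "\<Delta> = {F. F \<subseteq> {1..n} \<and> clique F E}" using assms by (simp add: clique_complex_def)
  have fin\<Delta>: "finite \<Delta>" unfolding \<Delta> by simp
  let ?Ws = "{W. W \<subseteq> {1..n} \<and> card W = j}"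
  have finW: "finite ?Ws" by simp
  have "(\<Sum>W\<in>?Ws. clique_euler E W) = (\<Sum>W\<in>?Ws. \<Sum>F | F \<in> \<Delta> \<and> F \<subseteq> W. (-1) ^ card F)"
    unfolding clique_euler_def \<Delta> by (intro sum.cong refl) auto
  also have "\<dots> = (\<Sum>F\<in>\<Delta>. \<Sum>W | W \<in> ?Ws \<and> F \<subseteq> W. (-1) ^ card F)"
    by (rule sum.swap_restrict[OF finW fin\<Delta>])
  also have "\<dots> = (\<Sum>F\<in>\<Delta>. (-1) ^ card F * int (if card F \<le> j then (n - card F) choose (j - card F) else 0))"
  proof (rule sum.cong[OF refl])
    fix F assume "F \<in> \<Delta>"
    then have "F \<subseteq> {1..n}" by (simp add: \<Delta>)
    moreover have "{W \<in> ?Ws. F \<subseteq> W} = {W. F \<subseteq> W \<and> W \<subseteq> {1..n} \<and> card W = j}" by auto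
    ultimately show "(\<Sum>W | W \<in> ?Ws \<and> F \<subseteq> W. (-1) ^ card F)
        = (-1) ^ card F * int (if card F \<le> j then (n - card F) choose (j - card F) else 0)"
      using card_supersets[of "{1..n}" F j] by (simp add: mult.commute)
  qed
  finally have "(-1) ^ j * (\<Sum>W\<in>?Ws. clique_euler E W)
      = (\<Sum>F\<in>\<Delta>. (-1) ^ j * ((-1) ^ card F * int (if card F \<le> j then (n - card F) choose (j - card F) else 0)))"
    by (simp only: sum_distrib_left)
  also have "\<dots> = (\<Sum>F\<in>\<Delta>. if card F \<le> j then (-1) ^ (j - card F) * int ((n - card F) choose (j - card F)) else 0)"
  proof (rule sum.cong[OF refl])
    fix F
    have "(-1 :: int) ^ j * (-1) ^ card F = (-1) ^ (j - card F)" if "card F \<le> j"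
      using that by (simp add: minus_one_power_iff)
    then show "(-1) ^ j * ((-1) ^ card F * int (if card F \<le> j then (n - card F) choose (j - card F) else 0))
        = (if card F \<le> j then (-1) ^ (j - card F) * int ((n - card F) choose (j - card F)) else 0)"
      by (simp add: mult.assoc[symmetric])
  qed
  also have "\<dots> = fps_nth (hilbert_series TYPE('k) n \<Delta> * (1 - fps_X) ^ n) j"
  proof (rule hilbert_series_mult[symmetric])
    show "card F \<le> n" if "F \<in> \<Delta>" for F
      using that card_mono[of "{1..n}" F] by (simp add: \<Delta>)
  qed (auto simp: \<Delta> intro: smaller_clique)
  finally show ?thesis by simp
qed

theorem corollary3p5:
  fixes n p d j :: nat and E :: "nat set set" and \<Delta> :: "nat set set"
  assumes "simple_graph {1..n} E"
    and "chordal E"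
    and "\<Delta> = clique_complex {1..n} E"
    and "int d = complex_dim \<Delta> + 1"
    and "projective_dimension (poly_ring n) (SR_module n \<Delta> :: ('k::field mpoly, _) module)
           = enat p"
    and "j > p + 2"
  shows "(\<Sum>l=0..j. (-1) ^ l * h_vector TYPE('k) n \<Delta> (j - l) * int ((n - d) choose l)) = 0"
proof -
  let ?H = "hilbert_series TYPE('k) n \<Delta>"
  have \<Delta>: "\<Delta> = {F. F \<subseteq> {1..n} \<and> clique F E}" using assms(3) by (simp add: clique_complex_def)
  have fin\<Delta>: "finite \<Delta>" and ne: "\<Delta> \<noteq> {}" unfolding \<Delta> by auto
  have down: "\<forall>F\<in>\<Delta>. Pow F \<subseteq> \<Delta>" using smaller_clique by (auto simp: \<Delta>)
  have le_d: "card F \<le> d" if "F \<in> \<Delta>" for F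
  proof -
    have "int (card F) - 1 \<le> complex_dim \<Delta>" unfolding complex_dim_def using fin\<Delta> that by (intro Max_ge) auto
    then show ?thesis using assms(4) by linarith
  qed
  have "complex_dim \<Delta> \<in> (\<lambda>F. int (card F) - 1) ` \<Delta>"
    unfolding complex_dim_def using fin\<Delta> ne by (intro Max_in) auto
  then obtain F where F: "F \<in> \<Delta>" "d = card F" using assms(4) by auto
  \<comment> \<open>Makes \<open>n - d\<close> a genuine difference, so that the exponents
    \<open>n - d\<close> and \<open>d\<close> add up to \<open>n\<close>.\<close>
  then have "d \<le> n" using card_mono[of "{1..n}" F] by (simp add: \<Delta>)
  \<comment> \<open>\<open>h_vector\<close> is set to 0 beyond \<open>d\<close>. The series agrees
    there because every face contributes a polynomial of degree at most \<open>d\<close>, so the sum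
    below is a full convolution.\<close>
  have h: "h_vector TYPE('k) n \<Delta> i = fps_nth (?H * (1 - fps_X) ^ d) i" for i
  proof (cases "i \<le> d")
    case True
    then show ?thesis using assms(4) by (simp add: h_vector_def Let_def flip: assms(4))
  next
    case False
    have "fps_nth (?H * (1 - fps_X) ^ d) i
        = (\<Sum>F\<in>\<Delta>. if card F \<le> i then (-1) ^ (i - card F) * int ((d - card F) choose (i - card F)) else 0)"
      by (rule hilbert_series_mult[OF down _ _ le_d]) (auto simp: \<Delta>)
    also have "\<dots> = 0"
    proof (rule sum.neutral, rule ballI)
      fix F assume "F \<in> \<Delta>"
      then have "d - card F < i - card F" using le_d[of F] False by linarith
      then show "(if card F \<le> i then (-1) ^ (i - card F) * int ((d - card F) choose (i - card F)) else 0) = 0"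
        by simp
    qed
    finally show ?thesis using False by (simp add: h_vector_def Let_def flip: assms(4))
  qed
  \<comment> \<open>The signed binomials are the coefficients of (1 - z)^(n - d), which turns the
    sum into a Cauchy product.\<close>
  have "(\<Sum>l=0..j. (-1) ^ l * h_vector TYPE('k) n \<Delta> (j - l) * int ((n - d) choose l))
      = (\<Sum>l=0..j. fps_nth ((1 - fps_X) ^ (n - d)) l * fps_nth (?H * (1 - fps_X) ^ d) (j - l))"
    by (simp add: h one_minus_fps_X_power_nth algebra_simps)
  also have "\<dots> = fps_nth ((1 - fps_X) ^ (n - d) * (?H * (1 - fps_X) ^ d)) j"
    by (rule fps_mult_nth[symmetric])
  also have "(1 - fps_X) ^ (n - d) * (?H * (1 - fps_X) ^ d) = ?H * (1 - fps_X) ^ n"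
    using \<open>d \<le> n\<close> by (simp add: mult.left_commute flip: power_add)
  also have "fps_nth \<dots> j = (-1) ^ j * (\<Sum>W | W \<subseteq> {1..n} \<and> card W = j. clique_euler E W)"
    by (rule hilbert_series_clique_complex[OF assms(3)])
  also have "(\<Sum>W | W \<subseteq> {1..n} \<and> card W = j. clique_euler E W) = 0"
  proof (rule sum.neutral, rule ballI)
    fix W assume "W \<in> {W. W \<subseteq> {1..n} \<and> card W = j}"
    then have W: "W \<subseteq> {1..n}" "card W = j" by auto
    then have "finite W" "W \<noteq> {}" using assms(6) finite_subset by auto
    have "graph_connected E W"
    proof (rule ccontr)
      assume "\<not> graph_connected E W"
      then obtain A where A: "A \<subset> W" "A \<noteq> {}" and sep: "\<And>a b. a \<in> A \<Longrightarrow> b \<in> W - A \<Longrightarrow> {a, b} \<notin> E"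
        unfolding graph_connected_def by blast
      have "card (A \<union> (W - A)) \<le> p + 1"
      proof (rule SR_module_projective_dimension_bound[OF assms(5) down])
        show "i \<in> {1..n} \<and> {i} \<in> \<Delta>" if "i \<in> A \<union> (W - A)" for i
          using that A W by (auto simp: \<Delta> clique_def)
        show "{a, b} \<notin> \<Delta>" if "a \<in> A" "b \<in> W - A" for a b
          using sep[OF that] that by (auto simp: \<Delta> clique_def)
      qed (use A in auto)
      moreover have "A \<union> (W - A) = W" using A by auto
      ultimately show False using W assms(6) by simp
    qed
    then show "clique_euler E W = 0"
      using chordal_connected_clique_euler[OF assms(2)] assms(1) \<open>finite W\<close> \<open>W \<noteq> {}\<close>
      by (simp add: simple_graph_def)
  qed
  finally show ?thesis by simp
qed

end
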